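(* Let $\phi\colon E\to G$ and $\phi'\colon E'\to G'$ be two quasi-equivalent multigraded maps (over polynomial rings $Q$ and $Q'$ respectively) of uniform rank $r$. Let $f\colon L_\phi\to L_{\phi'}$ be a QE-compatible map which preserves joins of any $s$ atoms, where $s\ge r+1$; that is, with $\epsilon_1,\dots,\epsilon_e$ and $\epsilon'_1,\dots,\epsilon'_e$ homogeneous bases of $E$ and $E'$ that are part of a QE-structure and satisfy $f(|\epsilon_i|)=|\epsilon'_i|$ for all $i$, one has $f\big(\bigvee_{i\in I}|\epsilon_i|\big)=\bigvee_{i\in I}f(|\epsilon_i|)$ for every $I\subseteq\{1,\dots,e\}$ with $|I|\ge r+1$. Let $F_\bullet(\phi)$ be the minimal free multigraded resolution of the cokernel of $\phi$, with $F_0=G$, $F_1=E$ and first differential $\phi$. Then the relabeled complex $f(F_\bullet(\phi))$ is a free resolution of the cokernel of $\phi'$ over $Q'$.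
   Context: **Setting.** $\Bbbk$ is a field; $Q=\Bbbk[x_1,\dots,x_n]$ and $Q'=\Bbbk[y_1,\dots,y_{n'}]$ are polynomial rings with their standard $\mathbb N^n$- and $\mathbb N^{n'}$-gradings ("multigradings"), $x^a$ having multidegree $a$. On multidegrees the join $\vee$ (lcm) is the componentwise maximum. $E,G$ are finite free multigraded $Q$-modules, $\phi\colon E\to G$ is a $Q$-linear map preserving multidegrees, and $E',G',\phi'$ are the same over $Q'$. The rank of $E$ is $e$, the rank of $E'$ is $e'$. **Coefficient matrix, uniform rank.** For homogeneous bases $\epsilon_1,\dots,\epsilon_e$ of $E$ and $\gamma_1,\dots,\gamma_g$ of $G$, the matrix of $\phi$ has entries $c_{ij}x^{a_{ij}}$ with $c_{ij}\in\Bbbk$; $C=(c_{ij})$ is the coefficient matrix. Let $U,W$ be the $\Bbbk$-vector spaces with bases $\epsilon_1,\dots,\epsilon_e$ and $\gamma_1,\dots,\gamma_g$, let $s\colon U\to W$ be the linear map with matrix $C$, and $V=\mathrm{im}(s)$. Define $U',W',s',V'$ analogously for $\phi'$. A multigraded map of rank $r$ is of uniform rank (here: of uniform rank $r$) if every submatrix of its coefficient matrix formed by all rows and any $r$ columns has rank $r$. **LCM-lattice.** $L_\phi=\{|\epsilon_I| : \emptyset\ne I\subseteq\{1,\dots,e\}\}$, where $|\epsilon_I|=\bigvee_{i\in I}|\epsilon_i|$; similarly $L_{\phi'}$. **Quasi-equivalence.** $\phi$ and $\phi'$ are quasi-equivalent if there exist homogeneous bases of $E$ and $E'$ and bases of $V$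 and $V'$ such that the matrices of the maps $U\to V$ and $U'\to V'$ induced by $s$ and $s'$ are the same (in particular $e=e'$). Such a choice of bases of $E,E',V,V'$ is called a QE-structure. If $\phi,\phi'$ are quasi-equivalent, a function of sets $f\colon L_\phi\to L_{\phi'}$ is QE-compatible if there exist homogeneous bases $\epsilon_1,\dots,\epsilon_e$ of $E$ and $\epsilon'_1,\dots,\epsilon'_e$ of $E'$ that are part of a QE-structure and satisfy $f(|\epsilon_i|)=|\epsilon'_i|$ for all $i$. **Relabeling.** Let $T_\bullet\colon 0\to T_p\xrightarrow{\phi_p}\cdots\to T_2\xrightarrow{\phi_2}T_1\xrightarrow{\phi}T_0\to0$ be a finite complex of finite free multigraded $Q$-modules with $T_0=G$, $T_1=E$, extending $\phi$, such that each $T_m$, $m\ge1$, has a homogeneous basis with multidegrees in $L_\phi$ (for $m=1$ use the basis $\epsilon_1,\dots,\epsilon_e$). The relabeled complex $f(T_\bullet)$ over $Q'$ is obtained as follows: replace $T_0$ by $G'$ and $\phi$ by $\phi'$; replace, for each $m\ge1$, each basis element of $T_m$ of multidegree $\alpha$ by a basis element of a free $Q'$-module of multidegree $f(\alpha)$ (for $m=1$ this gives $E'$ with basis element $\epsilon_i$ replaced by $\epsilon'_i$); and for $m\ge2$ replace each matrix entry $c\,x^{\alpha-\beta}$ ($c\in\Bbbk$) of $\phi_m$ from a basis element of multidegree $\alpha$ to one of multidegree $\beta$ by $c\,y^{f(\alpha)-f(\beta)}$. A minimal free multigraded resolution is a multigraded free resolution whose differentials have image in $(x_1,\dots,x_n)$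 times the target. *)

theory Defs
  imports "HOL-Library.Function_Algebras" "HOL-Library.Poly_Mapping"
    "Jordan_Normal_Form.DL_Rank" "Jordan_Normal_Form.DL_Submatrix"
begin

text \<open>
  Multidegrees are exponent vectors \<^typ>\<open>'n \<Rightarrow> nat\<close>, where the finite type \<open>'n\<close> indexes the
  variables.  Addition, truncated subtraction, \<open>\<le>\<close> and \<^const>\<open>sup\<close> on them are all componentwise,
  so that \<^const>\<open>sup\<close> is the lcm.  The polynomial ring is the monoid algebra of the multidegrees;
  \<^term>\<open>Poly_Mapping.single \<alpha> c\<close> is the term $c x^\alpha$.

  All modules occur as submodules of ambient modules, given by a scalar multiplication \<open>sc\<close>
  on a type.  A multigraded module is given by the family of its homogeneous components;
  its underlying module is their span.
\<close>

type_synonym 'n mdeg = "'n \<Rightarrow> nat"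
type_synonym ('n, 'k) mpoly = "'n mdeg \<Rightarrow>\<^sub>0 'k"
type_synonym ('n, 'k, 'a) scal = "('n, 'k) mpoly \<Rightarrow> 'a \<Rightarrow> 'a"
type_synonym ('n, 'a) graded = "'n mdeg \<Rightarrow> 'a set"

section \<open>Finite free multigraded modules and their maps\<close>

definition underlying ::
  "('n, 'k::field, 'a::ab_group_add) scal \<Rightarrow> ('n, 'a) graded \<Rightarrow> 'a set" where
  "underlying sc M = Modules.module.span sc (\<Union>\<alpha>. M \<alpha>)"

definition multigraded_module ::
  "('n, 'k::field, 'a::ab_group_add) scal \<Rightarrow> ('n, 'a) graded \<Rightarrow> bool" where
  "multigraded_module sc M \<longleftrightarrow>
     (\<forall>\<alpha>. 0 \<in> M \<alpha>) \<and>
     (\<forall>\<alpha>. \<forall>u\<in>M \<alpha>. \<forall>v\<in>M \<alpha>. u + v \<in> M \<alpha>) \<and>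
     (\<forall>\<alpha> \<beta> c. \<forall>u\<in>M \<alpha>. sc (Poly_Mapping.single \<beta> c) u \<in> M (\<beta> + \<alpha>)) \<and>
     (\<forall>A u. finite A \<longrightarrow> (\<forall>\<alpha>\<in>A. u \<alpha> \<in> M \<alpha>) \<longrightarrow> (\<Sum>\<alpha>\<in>A. u \<alpha>) = 0 \<longrightarrow> (\<forall>\<alpha>\<in>A. u \<alpha> = 0))"

text \<open>
  \<open>\<epsilon> i\<close>, for \<open>i < e\<close>, are the elements of the basis and \<open>a i\<close> is the multidegree of \<open>\<epsilon> i\<close>.
  The values of \<open>\<epsilon>\<close> and \<open>a\<close> at \<open>i \<ge> e\<close> are irrelevant.
\<close>

definition homogeneous_basis ::
  "('n, 'k::field, 'a::ab_group_add) scal \<Rightarrow> ('n, 'a) graded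
     \<Rightarrow> nat \<Rightarrow> (nat \<Rightarrow> 'a) \<Rightarrow> (nat \<Rightarrow> 'n mdeg) \<Rightarrow> bool" where
  "homogeneous_basis sc M e \<epsilon> a \<longleftrightarrow>
     inj_on \<epsilon> {..<e} \<and>
     \<not> Modules.module.dependent sc (\<epsilon> ` {..<e}) \<and>
     Modules.module.span sc (\<epsilon> ` {..<e}) = underlying sc M \<and>
     (\<forall>i<e. \<epsilon> i \<in> M (a i))"

definition finite_free ::
  "('n, 'k::field, 'a::ab_group_add) scal \<Rightarrow> ('n, 'a) graded \<Rightarrow> bool" where
  "finite_free sc M \<longleftrightarrow> multigraded_module sc M \<and> (\<exists>e \<epsilon> a. homogeneous_basis sc M e \<epsilon> a)"

definition linear_between ::
  "('n, 'k::field, 'a::ab_group_add) scal \<Rightarrow> ('n, 'a) graded \<Rightarrow> ('n, 'a) graded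
     \<Rightarrow> ('a \<Rightarrow> 'a) \<Rightarrow> bool" where
  "linear_between sc M N \<phi> \<longleftrightarrow>
     (\<forall>u\<in>underlying sc M. \<phi> u \<in> underlying sc N) \<and>
     (\<forall>u\<in>underlying sc M. \<forall>v\<in>underlying sc M. \<phi> (u + v) = \<phi> u + \<phi> v) \<and>
     (\<forall>q. \<forall>u\<in>underlying sc M. \<phi> (sc q u) = sc q (\<phi> u))"

definition multigraded_map ::
  "('n, 'k::field, 'a::ab_group_add) scal \<Rightarrow> ('n, 'a) graded \<Rightarrow> ('n, 'a) graded
     \<Rightarrow> ('a \<Rightarrow> 'a) \<Rightarrow> bool" where
  "multigraded_map sc M N \<phi> \<longleftrightarrow> linear_between sc M N \<phi> \<and> (\<forall>\<alpha>. \<phi> ` M \<alpha> \<subseteq> N \<alpha>)"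

definition map_rank ::
  "('n, 'k::field, 'a::ab_group_add) scal \<Rightarrow> ('n, 'a) graded \<Rightarrow> ('a \<Rightarrow> 'a) \<Rightarrow> nat" where
  "map_rank sc M \<phi> =
     Max {card S | S. finite S \<and> S \<subseteq> \<phi> ` underlying sc M \<and> \<not> Modules.module.dependent sc S}"

section \<open>Coefficient matrix and uniform rank\<close>

text \<open>
  \<open>C\<close> is determined by \<open>\<phi>\<close> and the two homogeneous bases: its entry \<open>(i, j)\<close> is the coefficient of the
  monomial of exponent \<open>a j - b i\<close>, and is zero if this exponent is not in $\mathbb{N}^n$.
\<close>

definition coefficient_matrix ::
  "('n, 'k::field, 'a::ab_group_add) scal \<Rightarrow> ('a \<Rightarrow> 'a)
     \<Rightarrow> nat \<Rightarrow> (nat \<Rightarrow> 'a) \<Rightarrow> (nat \<Rightarrow> 'n mdeg)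
     \<Rightarrow> nat \<Rightarrow> (nat \<Rightarrow> 'a) \<Rightarrow> (nat \<Rightarrow> 'n mdeg) \<Rightarrow> 'k mat \<Rightarrow> bool" where
  "coefficient_matrix sc \<phi> e \<epsilon> a g \<gamma> b C \<longleftrightarrow>
     C \<in> carrier_mat g e \<and>
     (\<forall>i<g. \<forall>j<e. C $$ (i, j) \<noteq> 0 \<longrightarrow> b i \<le> a j) \<and>
     (\<forall>j<e. \<phi> (\<epsilon> j) = (\<Sum>i<g. sc (Poly_Mapping.single (a j - b i) (C $$ (i, j))) (\<gamma> i)))"

definition presented_by ::
  "('n, 'k::field, 'a::ab_group_add) scal \<Rightarrow> ('n, 'a) graded \<Rightarrow> ('n, 'a) graded \<Rightarrow> ('a \<Rightarrow> 'a)
     \<Rightarrow> nat \<Rightarrow> (nat \<Rightarrow> 'a) \<Rightarrow> (nat \<Rightarrow> 'n mdeg)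
     \<Rightarrow> nat \<Rightarrow> (nat \<Rightarrow> 'a) \<Rightarrow> (nat \<Rightarrow> 'n mdeg) \<Rightarrow> 'k mat \<Rightarrow> bool" where
  "presented_by sc E G \<phi> e \<epsilon> a g \<gamma> b C \<longleftrightarrow>
     homogeneous_basis sc E e \<epsilon> a \<and> homogeneous_basis sc G g \<gamma> b \<and>
     coefficient_matrix sc \<phi> e \<epsilon> a g \<gamma> b C"

text \<open>
  The condition on the columns may depend on the homogeneous basis of the source that is used to
  form the coefficient matrix, which is therefore a parameter.
\<close>

definition uniform_rank ::
  "('n, 'k::field, 'a::ab_group_add) scal \<Rightarrow> ('n, 'a) graded \<Rightarrow> ('a \<Rightarrow> 'a) \<Rightarrow> 'k mat
     \<Rightarrow> nat \<Rightarrow> bool" where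
  "uniform_rank sc E \<phi> C r \<longleftrightarrow>
     map_rank sc E \<phi> = r \<and>
     (\<forall>J\<subseteq>{..<dim_col C}. card J = r \<longrightarrow> vec_space.rank (dim_row C) (submatrix C UNIV J) = r)"

section \<open>LCM-lattice and quasi-equivalence\<close>

definition lcm_lattice :: "nat \<Rightarrow> (nat \<Rightarrow> 'n mdeg) \<Rightarrow> 'n mdeg set" where
  "lcm_lattice e a = {Sup_fin (a ` I) | I. I \<noteq> {} \<and> I \<subseteq> {..<e}}"

text \<open>
  $U$ and $W$ are coordinatised by the given bases, so that $s$ is multiplication by \<open>C\<close> and
  $V$ is the column space of \<open>C\<close>.  A basis of $V$ is given as the list of columns of a matrix \<open>B\<close>;
  then the matrix of $U \to V$ is the matrix \<open>A\<close> with \<open>C = B * A\<close>.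
\<close>

definition image_basis :: "'k::field mat \<Rightarrow> 'k mat \<Rightarrow> bool" where
  "image_basis C B \<longleftrightarrow>
     dim_row B = dim_row C \<and> distinct (cols B) \<and>
     \<not> LinearCombinations.module.lin_dep class_ring
          (module_vec TYPE('k) (dim_row C)) (set (cols B)) \<and>
     vec_space.col_space (dim_row C) B = vec_space.col_space (dim_row C) C"

definition QE_structure ::
  "('n, 'k::field, 'a::ab_group_add) scal \<Rightarrow> ('n, 'a) graded \<Rightarrow> ('n, 'a) graded \<Rightarrow> ('a \<Rightarrow> 'a)
     \<Rightarrow> ('m, 'k, 'b::ab_group_add) scal \<Rightarrow> ('m, 'b) graded \<Rightarrow> ('m, 'b) graded \<Rightarrow> ('b \<Rightarrow> 'b)
     \<Rightarrow> nat \<Rightarrow> (nat \<Rightarrow> 'a) \<Rightarrow> (nat \<Rightarrow> 'n mdeg) \<Rightarrow> (nat \<Rightarrow> 'b) \<Rightarrow> (nat \<Rightarrow> 'm mdeg)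
     \<Rightarrow> nat \<Rightarrow> (nat \<Rightarrow> 'a) \<Rightarrow> (nat \<Rightarrow> 'n mdeg) \<Rightarrow> 'k mat
     \<Rightarrow> nat \<Rightarrow> (nat \<Rightarrow> 'b) \<Rightarrow> (nat \<Rightarrow> 'm mdeg) \<Rightarrow> 'k mat
     \<Rightarrow> 'k mat \<Rightarrow> 'k mat \<Rightarrow> bool" where
  "QE_structure sc E G \<phi> sc' E' G' \<phi>' e \<epsilon> a \<epsilon>' a' g \<gamma> b C g' \<gamma>' b' C' B B' \<longleftrightarrow>
     presented_by sc E G \<phi> e \<epsilon> a g \<gamma> b C \<and>
     presented_by sc' E' G' \<phi>' e \<epsilon>' a' g' \<gamma>' b' C' \<and>
     image_basis C B \<and> image_basis C' B' \<and>
     dim_col B = dim_col B' \<and>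
     (\<exists>A\<in>carrier_mat (dim_col B) e. C = B * A \<and> C' = B' * A)"

section \<open>Complexes and resolutions\<close>

text \<open>\<open>d m\<close> is the differential from \<open>T m\<close> to \<open>T (m - 1)\<close>; \<open>d 0\<close> is irrelevant.\<close>

definition multigraded_complex ::
  "('n, 'k::field, 'a::ab_group_add) scal \<Rightarrow> (nat \<Rightarrow> ('n, 'a) graded) \<Rightarrow> (nat \<Rightarrow> 'a \<Rightarrow> 'a)
     \<Rightarrow> bool" where
  "multigraded_complex sc T d \<longleftrightarrow>
     (\<forall>m. finite_free sc (T m)) \<and>
     (\<exists>p. \<forall>m>p. underlying sc (T m) = {0}) \<and>
     (\<forall>m. multigraded_map sc (T (Suc m)) (T m) (d (Suc m))) \<and>
     (\<forall>m. \<forall>u\<in>underlying sc (T (Suc (Suc m))). d (Suc m) (d (Suc (Suc m)) u) = 0)"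

text \<open>
  With \<open>T 0 = G\<close>, the condition on the image of \<open>d 1\<close> is exactness of
  $T_1 \to G \to \mathrm{coker}\,\phi \to 0$.
\<close>

definition free_resolution_coker ::
  "('n, 'k::field, 'a::ab_group_add) scal \<Rightarrow> (nat \<Rightarrow> ('n, 'a) graded) \<Rightarrow> (nat \<Rightarrow> 'a \<Rightarrow> 'a)
     \<Rightarrow> ('n, 'a) graded \<Rightarrow> ('n, 'a) graded \<Rightarrow> ('a \<Rightarrow> 'a) \<Rightarrow> bool" where
  "free_resolution_coker sc T d E G \<phi> \<longleftrightarrow>
     multigraded_complex sc T d \<and>
     T 0 = G \<and> d 1 ` underlying sc (T 1) = \<phi> ` underlying sc E \<and>
     (\<forall>m. {u \<in> underlying sc (T (Suc m)). d (Suc m) u = 0}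
            = d (Suc (Suc m)) ` underlying sc (T (Suc (Suc m))))"

definition variables_times ::
  "('n, 'k::field, 'a::ab_group_add) scal \<Rightarrow> ('n, 'a) graded \<Rightarrow> 'a set" where
  "variables_times sc M = Modules.module.span sc
     {sc (Poly_Mapping.single (\<lambda>j. if j = i then 1 else 0) 1) u | i u. u \<in> underlying sc M}"

definition minimal_free_resolution_coker ::
  "('n, 'k::field, 'a::ab_group_add) scal \<Rightarrow> (nat \<Rightarrow> ('n, 'a) graded) \<Rightarrow> (nat \<Rightarrow> 'a \<Rightarrow> 'a)
     \<Rightarrow> ('n, 'a) graded \<Rightarrow> ('n, 'a) graded \<Rightarrow> ('a \<Rightarrow> 'a) \<Rightarrow> bool" where
  "minimal_free_resolution_coker sc T d E G \<phi> \<longleftrightarrow>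
     free_resolution_coker sc T d E G \<phi> \<and>
     (\<forall>m. d (Suc m) ` underlying sc (T (Suc m)) \<subseteq> variables_times sc (T m))"

section \<open>Relabeling\<close>

text \<open>
  \<open>T m\<close> has rank \<open>N m\<close> and homogeneous basis \<open>t m\<close> with multidegrees \<open>\<delta> m\<close>, for \<open>m \<ge> 1\<close>;
  \<open>D m\<close> is the coefficient matrix of \<open>d m\<close>, for \<open>m \<ge> 2\<close>.
\<close>

definition complex_bases ::
  "('n, 'k::field, 'a::ab_group_add) scal \<Rightarrow> (nat \<Rightarrow> ('n, 'a) graded) \<Rightarrow> (nat \<Rightarrow> 'a \<Rightarrow> 'a)
     \<Rightarrow> (nat \<Rightarrow> nat) \<Rightarrow> (nat \<Rightarrow> nat \<Rightarrow> 'a) \<Rightarrow> (nat \<Rightarrow> nat \<Rightarrow> 'n mdeg) \<Rightarrow> (nat \<Rightarrow> 'k mat)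
     \<Rightarrow> bool" where
  "complex_bases sc T d N t \<delta> D \<longleftrightarrow>
     (\<forall>m\<ge>1. homogeneous_basis sc (T m) (N m) (t m) (\<delta> m)) \<and>
     (\<forall>m\<ge>1. coefficient_matrix sc (d (Suc m)) (N (Suc m)) (t (Suc m)) (\<delta> (Suc m))
               (N m) (t m) (\<delta> m) (D (Suc m)))"

text \<open>
  Relabeling the complex with the data \<open>N\<close>, \<open>\<delta>\<close>, \<open>D\<close> above is possible if \<open>f\<close> is defined at all the
  \<open>\<delta> m i\<close> and the new exponents are in $\mathbb{N}^{n'}$ for all nonzero entries.
\<close>

definition relabelable ::
  "('n mdeg \<Rightarrow> 'm mdeg) \<Rightarrow> 'n mdeg set \<Rightarrow> (nat \<Rightarrow> nat) \<Rightarrow> (nat \<Rightarrow> nat \<Rightarrow> 'n mdeg)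
     \<Rightarrow> (nat \<Rightarrow> 'k::field mat) \<Rightarrow> bool" where
  "relabelable f L N \<delta> D \<longleftrightarrow>
     (\<forall>m\<ge>1. \<forall>i<N m. \<delta> m i \<in> L) \<and>
     (\<forall>m\<ge>1. \<forall>i<N m. \<forall>j<N (Suc m). D (Suc m) $$ (i, j) \<noteq> 0 \<longrightarrow> f (\<delta> m i) \<le> f (\<delta> (Suc m) j))"

text \<open>
  Since \<open>f\<close> is applied to the multidegrees while the coefficients are unchanged, the relabeled
  complex has the same matrices \<open>D\<close>, in bases with multidegrees \<open>f (\<delta> m i)\<close>.  It is unique up to
  isomorphism.  It is not required here to be a complex.
\<close>

definition relabeled ::
  "('n mdeg \<Rightarrow> 'm mdeg) \<Rightarrow> (nat \<Rightarrow> nat) \<Rightarrow> (nat \<Rightarrow> nat \<Rightarrow> 'n mdeg) \<Rightarrow> (nat \<Rightarrow> 'k::field mat)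
     \<Rightarrow> ('m, 'k, 'b::ab_group_add) scal \<Rightarrow> ('m, 'b) graded \<Rightarrow> ('m, 'b) graded \<Rightarrow> ('b \<Rightarrow> 'b)
     \<Rightarrow> (nat \<Rightarrow> 'b) \<Rightarrow> (nat \<Rightarrow> ('m, 'b) graded) \<Rightarrow> (nat \<Rightarrow> 'b \<Rightarrow> 'b) \<Rightarrow> bool" where
  "relabeled f N \<delta> D sc' E' G' \<phi>' \<epsilon>' T' d' \<longleftrightarrow>
     T' 0 = G' \<and> T' 1 = E' \<and> (\<forall>u\<in>underlying sc' E'. d' 1 u = \<phi>' u) \<and>
     (\<forall>m\<ge>1. multigraded_module sc' (T' m) \<and> linear_between sc' (T' (Suc m)) (T' m) (d' (Suc m))) \<and>
     (\<exists>t'. t' 1 = \<epsilon>' \<and> complex_bases sc' T' d' N t' (\<lambda>m i. f (\<delta> m i)) D)"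

end

theory Submission
  imports Defs
begin

text \<open>
  Fix the coefficient matrix \<open>C\<close> of \<open>\<phi>\<close> and write \<open>|I|\<close> for the join of the degrees \<open>a i\<close>,
  \<open>i \<in> I\<close>.  Exactness can be tested one multidegree at a time.  In multidegree \<open>\<alpha>\<close> a free
  module with a homogeneous basis is the coordinate space on the basis elements of degree \<open>\<le> \<alpha>\<close>,
  and a multigraded map acts there by its coefficient matrix.  So a complex is exact exactly if, for
  each \<open>\<alpha>\<close>, its coefficient matrices form an exact complex on these coordinate subspaces
  (\<open>exact_iff_strands_exact\<close>).  Relabeling changes neither the coefficient matrices above homological
  degree 1 nor, by quasi-equivalence, the kernel of the first one, since \<open>C = B * A\<close> and
  \<open>C' = B' * A\<close> both have the kernel of \<open>A\<close> (\<open>image_basis_kernel\<close>).  What has to be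
  understood is which coordinate subspaces occur.

  Uniform rank says that any \<open>r\<close> columns of \<open>C\<close> are independent.  Therefore a multidegree that lies
  above at most \<open>r\<close> of the \<open>a i\<close> has no first syzygies, and then minimality leaves no basis
  element at all in homological degree at least 2 there.  Hence every basis element in homological
  degree at least 2 has a degree above at least \<open>r + 1\<close> of the \<open>a i\<close> (\<open>many_atoms_below\<close>).  Moreover
  this degree is the join of these \<open>a i\<close> (\<open>degree_eq_Sup_atoms_below\<close>): the boundary of the basis
  element already lives in the degree of the join, so by exactness it is the boundary of an element
  there, and the difference would be a cycle that contradicts minimality.

  Now take a multidegree \<open>\<beta>\<close> on the relabeled side, and let \<open>J\<close> be the set of those \<open>i\<close> with
  \<open>f (a i) \<le> \<beta>\<close>.  If \<open>J\<close> has more than \<open>r\<close> elements, then, because \<open>f\<close> preserves the joins of more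
  than \<open>r\<close> of the \<open>a i\<close>, the relabeled degrees that are \<open>\<le> \<beta>\<close> are exactly those coming from degrees
  \<open>\<le> |J|\<close>.  So the strand in degree \<open>\<beta>\<close> is a strand of the original resolution, in homological
  degrees at least 1.  Otherwise it vanishes in homological degrees at least 2, and in homological
  degree 1 it consists of at most \<open>r\<close> columns, which are independent
  (\<open>relabeled_strands_exact\<close>).
\<close>

section \<open>Polynomials and linear systems over them\<close>

lemma poly_mapping_sum_single:
  fixes p :: "'a \<Rightarrow>\<^sub>0 'b::comm_monoid_add"
  assumes "finite S" "Poly_Mapping.keys p \<subseteq> S"
  shows "p = (\<Sum>\<beta>\<in>S. Poly_Mapping.single \<beta> (Poly_Mapping.lookup p \<beta>))"
proof (rule poly_mapping_eqI)
  fix k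
  have "(\<Sum>\<beta>\<in>S. Poly_Mapping.lookup (Poly_Mapping.single \<beta> (Poly_Mapping.lookup p \<beta>)) k)
      = (\<Sum>\<beta>\<in>S. if \<beta> = k then Poly_Mapping.lookup p k else 0)"
    by (rule sum.cong) (auto simp: lookup_single when_def)
  also have "\<dots> = Poly_Mapping.lookup p k"
    using assms by (auto simp: in_keys_iff)
  finally show "Poly_Mapping.lookup p k
      = Poly_Mapping.lookup (\<Sum>\<beta>\<in>S. Poly_Mapping.single \<beta> (Poly_Mapping.lookup p \<beta>)) k"
    by (simp add: lookup_sum)
qed

lemma lookup_mult_keys:
  fixes p q :: "'n mdeg \<Rightarrow>\<^sub>0 'k::comm_semiring_1"
  shows "Poly_Mapping.lookup (p * q) \<gamma> =
    (\<Sum>\<alpha>\<in>Poly_Mapping.keys p. \<Sum>\<beta>\<in>Poly_Mapping.keys q.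
       (Poly_Mapping.lookup p \<alpha> * Poly_Mapping.lookup q \<beta> when \<alpha> + \<beta> = \<gamma>))"
proof -
  let ?P = "Poly_Mapping.keys p" and ?Q = "Poly_Mapping.keys q"
  have "p * q = (\<Sum>\<alpha>\<in>?P. Poly_Mapping.single \<alpha> (Poly_Mapping.lookup p \<alpha>))
              * (\<Sum>\<beta>\<in>?Q. Poly_Mapping.single \<beta> (Poly_Mapping.lookup q \<beta>))"
    using poly_mapping_sum_single[of ?P p] poly_mapping_sum_single[of ?Q q] by simp
  also have "\<dots> = (\<Sum>\<alpha>\<in>?P. \<Sum>\<beta>\<in>?Q.
      Poly_Mapping.single (\<alpha> + \<beta>) (Poly_Mapping.lookup p \<alpha> * Poly_Mapping.lookup q \<beta>))"
    by (simp add: sum_product mult_single)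
  finally show ?thesis by (simp add: lookup_sum lookup_single)
qed

text \<open>
  Evaluating at a large \<open>K\<close> the univariate polynomial with the exponents as coefficients is
  additive, and two distinct exponents give distinct polynomials, which agree at finitely many points
  only.
\<close>

lemma exists_additive_separating:
  fixes A :: "('n::finite \<Rightarrow> nat) set"
  assumes "finite A"
  shows "\<exists>\<kappa> :: ('n \<Rightarrow> nat) \<Rightarrow> nat. (\<forall>\<alpha> \<beta>. \<kappa> (\<alpha> + \<beta>) = \<kappa> \<alpha> + \<kappa> \<beta>) \<and> inj_on \<kappa> A"
proof -
  obtain h :: "'n \<Rightarrow> nat" where h: "inj h"
    using finite_imp_inj_to_nat_seg[of "UNIV :: 'n set"] by auto
  define P :: "('n \<Rightarrow> nat) \<Rightarrow> int poly" where "P \<alpha> = (\<Sum>i\<in>UNIV. monom (int (\<alpha> i)) (h i))" for \<alpha>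
  have coeffP: "coeff (P \<alpha>) (h i) = int (\<alpha> i)" for \<alpha> i
  proof -
    have "coeff (P \<alpha>) (h i) = (\<Sum>j\<in>UNIV. if j = i then int (\<alpha> i) else 0)"
      unfolding P_def coeff_sum by (rule sum.cong) (auto simp: inj_eq[OF h])
    then show ?thesis by simp
  qed
  have injP: "P \<alpha> \<noteq> P \<beta>" if "\<alpha> \<noteq> \<beta>" for \<alpha> \<beta>
    using that coeffP by (metis ext of_nat_eq_iff)
  define R where "R = (\<Union>\<alpha>\<in>A. \<Union>\<beta>\<in>A - {\<alpha>}. {x. poly (P \<alpha> - P \<beta>) x = 0})"
  have "finite R"
    unfolding R_def using assms injP by (intro finite_UN_I finite_Diff poly_roots_finite) auto
  then have "\<exists>K::nat. int K \<notin> R"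
    by (metis finite_imageD finite_subset image_subsetI infinite_UNIV_nat inj_on_of_nat)
  then obtain K :: nat where K: "int K \<notin> R" by blast
  define \<kappa> :: "('n \<Rightarrow> nat) \<Rightarrow> nat" where "\<kappa> \<alpha> = (\<Sum>i\<in>UNIV. \<alpha> i * K ^ h i)" for \<alpha>
  have poly: "poly (P \<alpha>) (int K) = int (\<kappa> \<alpha>)" for \<alpha>
    by (simp add: P_def \<kappa>_def poly_sum poly_monom)
  show ?thesis
  proof (intro exI conjI allI)
    show "\<kappa> (\<alpha> + \<beta>) = \<kappa> \<alpha> + \<kappa> \<beta>" for \<alpha> \<beta>
      by (simp add: \<kappa>_def sum.distrib algebra_simps)
    show "inj_on \<kappa> A"
    proof (rule inj_onI, rule ccontr)
      fix \<alpha> \<beta> assume "\<alpha> \<in> A" "\<beta> \<in> A" "\<kappa> \<alpha> = \<kappa> \<beta>" "\<alpha> \<noteq> \<beta>"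
      then have "int K \<in> R" by (auto simp: R_def poly)
      with K show False ..
    qed
  qed
qed

text \<open>
  With respect to an additive weight that separates the exponents involved, the product of the two
  terms of highest weight cannot cancel.
\<close>

lemma mpoly_no_zero_divisors:
  fixes p q :: "('n::finite, 'k::field) mpoly"
  assumes "p \<noteq> 0" "q \<noteq> 0"
  shows "p * q \<noteq> 0"
proof -
  let ?P = "Poly_Mapping.keys p" and ?Q = "Poly_Mapping.keys q"
  have fin: "finite (?P \<union> ?Q)" by simp
  obtain \<kappa> :: "('n \<Rightarrow> nat) \<Rightarrow> nat"
    where add: "\<forall>\<alpha> \<beta>. \<kappa> (\<alpha> + \<beta>) = \<kappa> \<alpha> + \<kappa> \<beta>" and inj: "inj_on \<kappa> (?P \<union> ?Q)"
    using exists_additive_separating[OF fin] by blast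
  have max: "\<exists>\<alpha>0\<in>S. \<forall>\<alpha>\<in>S. \<kappa> \<alpha> \<le> \<kappa> \<alpha>0" if "finite S" "S \<noteq> {}" for S
    using Max_in[of "\<kappa> ` S"] Max_ge[of "\<kappa> ` S"] that by fastforce
  have "?P \<noteq> {}" "?Q \<noteq> {}" using assms by auto
  then obtain \<alpha>0 \<beta>0 where a0: "\<alpha>0 \<in> ?P" "\<And>\<alpha>. \<alpha> \<in> ?P \<Longrightarrow> \<kappa> \<alpha> \<le> \<kappa> \<alpha>0"
    and b0: "\<beta>0 \<in> ?Q" "\<And>\<beta>. \<beta> \<in> ?Q \<Longrightarrow> \<kappa> \<beta> \<le> \<kappa> \<beta>0"
    using max[of ?P] max[of ?Q] by auto
  have uniq: "\<alpha> = \<alpha>0 \<and> \<beta> = \<beta>0" if "\<alpha> \<in> ?P" "\<beta> \<in> ?Q" "\<alpha> + \<beta> = \<alpha>0 + \<beta>0" for \<alpha> \<beta>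
  proof -
    have "\<kappa> \<alpha> + \<kappa> \<beta> = \<kappa> \<alpha>0 + \<kappa> \<beta>0" using that(3) add by metis
    then have "\<kappa> \<alpha> = \<kappa> \<alpha>0" "\<kappa> \<beta> = \<kappa> \<beta>0" using a0(2)[OF that(1)] b0(2)[OF that(2)] by auto
    then show ?thesis using inj that a0(1) b0(1) by (auto dest: inj_onD)
  qed
  have "Poly_Mapping.lookup (p * q) (\<alpha>0 + \<beta>0) = (\<Sum>\<alpha>\<in>?P. \<Sum>\<beta>\<in>?Q.
      (Poly_Mapping.lookup p \<alpha> * Poly_Mapping.lookup q \<beta> when \<alpha> + \<beta> = \<alpha>0 + \<beta>0))"
    by (rule lookup_mult_keys)
  also have "\<dots> = (\<Sum>\<alpha>\<in>?P. \<Sum>\<beta>\<in>?Q. if \<beta> = \<beta>0 then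
      (if \<alpha> = \<alpha>0 then Poly_Mapping.lookup p \<alpha>0 * Poly_Mapping.lookup q \<beta>0 else 0) else 0)"
    by (intro sum.cong refl) (use uniq in \<open>auto simp: when_def\<close>)
  also have "\<dots> = Poly_Mapping.lookup p \<alpha>0 * Poly_Mapping.lookup q \<beta>0"
    using a0(1) b0(1) by simp
  finally show ?thesis using a0(1) b0(1) by (auto simp: in_keys_iff)
qed

text \<open>
  Gaussian elimination without division: each step multiplies by the pivot.  This is why zero divisors
  are excluded.
\<close>

lemma nontrivial_solution_of_homogeneous_system:
  fixes M :: "'v \<Rightarrow> nat \<Rightarrow> 'r::comm_ring_1"
  assumes dom: "\<And>p q :: 'r. p \<noteq> 0 \<Longrightarrow> q \<noteq> 0 \<Longrightarrow> p * q \<noteq> 0"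
    and "finite V" "card V > e"
  shows "\<exists>c. (\<exists>v\<in>V. c v \<noteq> 0) \<and> (\<forall>j<e. (\<Sum>v\<in>V. c v * M v j) = 0)"
  using assms(2,3)
proof (induction e arbitrary: V M)
  case 0
  then obtain v where "v \<in> V" by fastforce
  then show ?case by (intro exI[of _ "\<lambda>_. 1"]) auto
next
  case (Suc e)
  show ?case
  proof (cases "\<forall>v\<in>V. M v e = 0")
    case True
    from Suc.IH[of V M] Suc.prems obtain c where
      c: "\<exists>v\<in>V. c v \<noteq> 0" "\<forall>j<e. (\<Sum>v\<in>V. c v * M v j) = 0" by auto
    show ?thesis
      by (intro exI[of _ c]) (use c True in \<open>auto simp: less_Suc_eq\<close>)
  next
    case False
    then obtain w where w: "w \<in> V" "M w e \<noteq> 0" by blast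
    define M' where "M' v j = M w e * M v j - M v e * M w j" for v j
    have "e < card (V - {w})" using Suc.prems w by (simp add: card_Diff_singleton)
    with Suc.IH[of "V - {w}" M'] Suc.prems obtain c where
      c: "\<exists>v\<in>V - {w}. c v \<noteq> 0" "\<forall>j<e. (\<Sum>v\<in>V - {w}. c v * M' v j) = 0"
      by auto
    define c' where
      "c' v = (if v = w then - (\<Sum>u\<in>V - {w}. c u * M u e) else c v * M w e)" for v
    have "(\<Sum>v\<in>V. c' v * M v j) = (\<Sum>v\<in>V - {w}. c v * M' v j)" for j
    proof -
      have "(\<Sum>v\<in>V. c' v * M v j) = c' w * M w j + (\<Sum>v\<in>V - {w}. c' v * M v j)"
        using w Suc.prems by (meson sum.remove)
      also have "(\<Sum>v\<in>V - {w}. c' v * M v j) = (\<Sum>v\<in>V - {w}. c v * M w e * M v j)"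
        by (rule sum.cong) (auto simp: c'_def)
      also have "c' w * M w j = (\<Sum>v\<in>V - {w}. - (c v * M v e * M w j))"
        by (simp add: c'_def sum_distrib_right sum_negf)
      finally show ?thesis
        by (simp add: M'_def sum.distrib[symmetric] algebra_simps)
    qed
    moreover have "(\<Sum>v\<in>V - {w}. c v * M' v e) = 0" by (simp add: M'_def mult.commute)
    moreover have "\<exists>v\<in>V. c' v \<noteq> 0" using c(1) w dom by (auto simp: c'_def)
    ultimately show ?thesis
      by (intro exI[of _ c']) (use c(2) in \<open>auto simp: less_Suc_eq\<close>)
  qed
qed

text \<open>
  Exponents are nonnegative, so only the constant terms of the factors contribute to the constant term
  of a product.
\<close>

lemma lookup_mult_zero:
  fixes p q :: "('n, 'k::field) mpoly"
  assumes "Poly_Mapping.lookup q 0 = 0"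
  shows "Poly_Mapping.lookup (p * q) 0 = 0"
  unfolding lookup_mult_keys
proof (intro sum.neutral ballI)
  fix \<alpha> \<beta> :: "'n mdeg"
  have "\<beta> = 0" if "\<alpha> + \<beta> = 0" using that by (auto simp: fun_eq_iff)
  then show "(Poly_Mapping.lookup p \<alpha> * Poly_Mapping.lookup q \<beta> when \<alpha> + \<beta> = 0) = 0"
    using assms by (auto simp: when_def)
qed

lemma (in Modules.module) card_independent_in_finite_span:
  assumes dom: "\<And>p q :: 'a. p \<noteq> 0 \<Longrightarrow> q \<noteq> 0 \<Longrightarrow> p * q \<noteq> 0"
    and "finite S" "independent S" and S: "\<And>s. s \<in> S \<Longrightarrow> \<exists>q. s = (\<Sum>j<e. scale (q j) (v j))"
  shows "card S \<le> e"
proof (rule ccontr)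
  assume "\<not> card S \<le> e"
  obtain M where M: "\<And>s. s \<in> S \<Longrightarrow> s = (\<Sum>j<e. scale (M s j) (v j))" using S by metis
  obtain c where c: "\<exists>s\<in>S. c s \<noteq> 0" "\<forall>j<e. (\<Sum>s\<in>S. c s * M s j) = 0"
    using nontrivial_solution_of_homogeneous_system[OF dom \<open>finite S\<close>, of e M] \<open>\<not> card S \<le> e\<close>
    by auto
  have "(\<Sum>s\<in>S. scale (c s) s) = (\<Sum>s\<in>S. \<Sum>j<e. scale (c s * M s j) (v j))"
  proof (rule sum.cong[OF refl])
    fix s assume "s \<in> S"
    then have "scale (c s) s = scale (c s) (\<Sum>j<e. scale (M s j) (v j))" using M by metis
    then show "scale (c s) s = (\<Sum>j<e. scale (c s * M s j) (v j))" by (simp add: scale_sum_right)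
  qed
  also have "\<dots> = (\<Sum>j<e. scale (\<Sum>s\<in>S. c s * M s j) (v j))"
    by (subst sum.swap) (simp add: scale_sum_left)
  also have "\<dots> = 0" using c(2) by simp
  finally have "(\<Sum>s\<in>S. scale (c s) s) = 0" .
  then have "c s = 0" if "s \<in> S" for s
    using independentD[OF assms(3,2) subset_refl _ that] by blast
  then show False using c(1) by blast
qed

section \<open>Homogeneous components in coordinates\<close>

lemma mdeg_add_diff: "\<beta> \<le> \<alpha> \<Longrightarrow> \<beta> + (\<alpha> - \<beta>) = (\<alpha> :: 'n mdeg)"
  by (auto simp: fun_eq_iff le_fun_def)

lemma mdeg_diff_add_diff:
  "\<gamma> \<le> \<beta> \<Longrightarrow> \<beta> \<le> \<alpha> \<Longrightarrow> (\<alpha> - \<beta>) + (\<beta> - \<gamma>) = \<alpha> - (\<gamma> :: 'n mdeg)"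
proof
  fix x assume "\<gamma> \<le> \<beta>" "\<beta> \<le> \<alpha>"
  then have "\<gamma> x \<le> \<beta> x" "\<beta> x \<le> \<alpha> x" by (auto simp: le_fun_def)
  then show "((\<alpha> - \<beta>) + (\<beta> - \<gamma>)) x = (\<alpha> - \<gamma>) x" by simp
qed

text \<open>
  Coordinates, in a basis with degrees \<open>a\<close>, of the elements of multidegree \<open>\<alpha>\<close>: the basis
  element \<open>i\<close> occurs with the monomial of exponent \<open>\<alpha> - a i\<close>, so \<open>a i \<le> \<alpha>\<close> is required.
  Coordinate vectors vanish outside the index range, which makes them determined by the element.
\<close>

definition strand :: "nat \<Rightarrow> (nat \<Rightarrow> 'n mdeg) \<Rightarrow> 'n mdeg \<Rightarrow> (nat \<Rightarrow> 'k::zero) set" where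
  "strand e a \<alpha> = {c. \<forall>i. c i \<noteq> 0 \<longrightarrow> i < e \<and> a i \<le> \<alpha>}"

definition mat_apply :: "'k::field mat \<Rightarrow> nat \<Rightarrow> nat \<Rightarrow> (nat \<Rightarrow> 'k) \<Rightarrow> nat \<Rightarrow> 'k" where
  "mat_apply C g e c = (\<lambda>i. if i < g then \<Sum>j<e. C $$ (i, j) * c j else 0)"

lemma zero_in_strand: "0 \<in> strand e a \<alpha>"
  by (simp add: strand_def)

lemma mat_apply_zero [simp]: "mat_apply C g e 0 = 0"
  by (auto simp: mat_apply_def)

lemma mat_apply_in_strand:
  assumes C: "\<forall>i<g. \<forall>j<e. C $$ (i, j) \<noteq> 0 \<longrightarrow> b i \<le> a j" and c: "c \<in> strand e a \<alpha>"
  shows "mat_apply C g e c \<in> strand g b \<alpha>"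
proof -
  have "b i \<le> \<alpha>" if i: "i < g" and "(\<Sum>j<e. C $$ (i, j) * c j) \<noteq> 0" for i
  proof -
    obtain j where "j < e" "C $$ (i, j) * c j \<noteq> 0"
      using \<open>(\<Sum>j<e. C $$ (i, j) * c j) \<noteq> 0\<close> by (meson lessThan_iff sum.neutral)
    then have "b i \<le> a j" "a j \<le> \<alpha>" using C i c by (auto simp: strand_def)
    then show ?thesis by (rule order_trans)
  qed
  then show ?thesis by (auto simp: strand_def mat_apply_def)
qed

lemma mat_apply_diff: "mat_apply C g e (u - w) = mat_apply C g e u - mat_apply C g e w"
  by (auto simp: mat_apply_def fun_eq_iff algebra_simps sum_subtractf)

lemma diff_in_strand:
  fixes u w :: "nat \<Rightarrow> 'k::ab_group_add"
  assumes "u \<in> strand e a \<alpha>" "w \<in> strand e a \<alpha>"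
  shows "u - w \<in> strand e a \<alpha>"
proof -
  have "u i \<noteq> 0 \<or> w i \<noteq> 0" if "(u - w) i \<noteq> 0" for i using that by auto
  then show ?thesis using assms by (auto simp: strand_def)
qed

text \<open>
  The homogeneous components are only assumed to be compatible with the action and independent; that
  the basis determines them is \<open>component_iff\<close> below.
\<close>

locale based_module = Modules.module sc
  for sc :: "('n::finite, 'k::field, 'a::ab_group_add) scal"
    and M :: "('n, 'a) graded" and e :: nat and \<epsilon> :: "nat \<Rightarrow> 'a" and a :: "nat \<Rightarrow> 'n mdeg" +
  assumes graded: "multigraded_module sc M" and basis: "homogeneous_basis sc M e \<epsilon> a"
begin

definition elem :: "'n mdeg \<Rightarrow> (nat \<Rightarrow> 'k) \<Rightarrow> 'a" where
  "elem \<alpha> c = (\<Sum>i<e. sc (Poly_Mapping.single (\<alpha> - a i) (c i)) (\<epsilon> i))"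

lemma zero_in: "0 \<in> M \<alpha>"
  using graded by (simp add: multigraded_module_def)

lemma add_in: "u \<in> M \<alpha> \<Longrightarrow> v \<in> M \<alpha> \<Longrightarrow> u + v \<in> M \<alpha>"
  using graded by (simp add: multigraded_module_def)

lemma scale_in: "u \<in> M \<alpha> \<Longrightarrow> sc (Poly_Mapping.single \<beta> k) u \<in> M (\<beta> + \<alpha>)"
  using graded by (simp add: multigraded_module_def)

lemma sum_in: "(\<And>x. x \<in> X \<Longrightarrow> h x \<in> M \<alpha>) \<Longrightarrow> sum h X \<in> M \<alpha>"
  by (induction X rule: infinite_finite_induct) (auto intro: zero_in add_in)

lemma diff_in:
  assumes "u \<in> M \<alpha>" "v \<in> M \<alpha>"
  shows "u - v \<in> M \<alpha>"
proof -
  have "sc (Poly_Mapping.single 0 (- 1)) v \<in> M (0 + \<alpha>)" using assms(2) by (rule scale_in)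
  moreover have "sc (Poly_Mapping.single 0 (- 1)) v = - v"
    by (simp only: single_uminus single_one scale_minus_left scale_one)
  ultimately have "- v \<in> M \<alpha>" by (simp only: add_0_left)
  from add_in[OF assms(1) this] show ?thesis by simp
qed

lemma components_zero:
  assumes "finite A" "\<And>\<alpha>. \<alpha> \<in> A \<Longrightarrow> u \<alpha> \<in> M \<alpha>" "(\<Sum>\<alpha>\<in>A. u \<alpha>) = 0" "\<alpha> \<in> A"
  shows "u \<alpha> = 0"
proof -
  have "\<forall>A u. finite A \<longrightarrow> (\<forall>\<alpha>\<in>A. u \<alpha> \<in> M \<alpha>) \<longrightarrow> (\<Sum>\<alpha>\<in>A. u \<alpha>) = 0 \<longrightarrow> (\<forall>\<alpha>\<in>A. u \<alpha> = 0)"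
    using graded unfolding multigraded_module_def by (elim conjE)
  from this[rule_format, of A u, OF assms] show ?thesis .
qed

text \<open>
  Subtracting \<open>u\<close> from the \<open>\<alpha>\<close>-th summand turns the equation into a relation between homogeneous
  components.
\<close>

lemma component_eq:
  assumes "finite A" "\<And>\<beta>. \<beta> \<in> A \<Longrightarrow> v \<beta> \<in> M \<beta>" "u \<in> M \<alpha>" "u = (\<Sum>\<beta>\<in>A. v \<beta>)" "\<alpha> \<in> A"
  shows "u = v \<alpha>"
proof -
  define w where "w \<beta> = v \<beta> - (if \<beta> = \<alpha> then u else 0)" for \<beta>
  have "(\<Sum>\<beta>\<in>A. w \<beta>) = 0" using assms by (simp add: w_def sum_subtractf)
  then have "w \<alpha> = 0"
    by (rule components_zero[rotated 2]) (use assms in \<open>auto simp: w_def intro: diff_in\<close>)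
  then show ?thesis by (simp add: w_def)
qed

lemma subset_underlying: "M \<alpha> \<subseteq> underlying sc M"
  unfolding underlying_def by (auto intro: span_base)

lemma underlying_sum: "(\<And>x. x \<in> X \<Longrightarrow> h x \<in> underlying sc M) \<Longrightarrow> sum h X \<in> underlying sc M"
  unfolding underlying_def by (rule span_sum)

lemma basis_in: "i < e \<Longrightarrow> \<epsilon> i \<in> M (a i)"
  using basis by (simp add: homogeneous_basis_def)

lemma basis_independent:
  assumes "(\<Sum>i<e. sc (q i) (\<epsilon> i)) = 0" "i < e"
  shows "q i = 0"
proof -
  have inj: "inj_on \<epsilon> {..<e}" and ind: "independent (\<epsilon> ` {..<e})"
    using basis by (auto simp: homogeneous_basis_def)
  define u where "u v = q (the_inv_into {..<e} \<epsilon> v)" for v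
  have u: "u (\<epsilon> j) = q j" if "j < e" for j
    using that by (simp add: u_def the_inv_into_f_f[OF inj])
  have "(\<Sum>v\<in>\<epsilon> ` {..<e}. sc (u v) v) = (\<Sum>i<e. sc (q i) (\<epsilon> i))"
    unfolding sum.reindex[OF inj] by (rule sum.cong) (auto simp: u)
  then have "u (\<epsilon> i) = 0"
    using independentD[OF ind _ subset_refl, of u "\<epsilon> i"] assms by simp
  then show ?thesis using u assms(2) by simp
qed

lemma underlying_iff: "u \<in> underlying sc M \<longleftrightarrow> (\<exists>q. u = (\<Sum>i<e. sc (q i) (\<epsilon> i)))"
proof
  have inj: "inj_on \<epsilon> {..<e}" and sp: "span (\<epsilon> ` {..<e}) = underlying sc M"
    using basis by (auto simp: homogeneous_basis_def)
  {
    assume "u \<in> underlying sc M"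
    then obtain p where "u = (\<Sum>v\<in>\<epsilon> ` {..<e}. sc (p v) v)"
      unfolding sp[symmetric] span_finite[OF finite_imageI[OF finite_lessThan]] by auto
    then show "\<exists>q. u = (\<Sum>i<e. sc (q i) (\<epsilon> i))"
      by (intro exI[of _ "p \<circ> \<epsilon>"]) (simp add: sum.reindex[OF inj])
  next
    assume "\<exists>q. u = (\<Sum>i<e. sc (q i) (\<epsilon> i))"
    then show "u \<in> underlying sc M"
      unfolding sp[symmetric] by (elim exE, simp only:) (intro span_sum span_scale span_base imageI)
  }
qed

lemma elem_in:
  assumes "c \<in> strand e a \<alpha>"
  shows "elem \<alpha> c \<in> M \<alpha>"
  unfolding elem_def
proof (rule sum_in)
  fix i assume "i \<in> {..<e}"
  then have i: "i < e" by simp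
  show "sc (Poly_Mapping.single (\<alpha> - a i) (c i)) (\<epsilon> i) \<in> M \<alpha>"
  proof (cases "c i = 0")
    case True
    then show ?thesis by (simp add: zero_in)
  next
    case False
    then have "\<alpha> - a i + a i = \<alpha>"
      using assms mdeg_add_diff[of "a i" \<alpha>] by (simp add: strand_def add.commute)
    then show ?thesis using scale_in[OF basis_in[OF i]] by metis
  qed
qed

lemma elem_inject:
  assumes "c \<in> strand e a \<alpha>" "c' \<in> strand e a \<alpha>" "elem \<alpha> c = elem \<alpha> c'"
  shows "c = c'"
proof
  fix i
  show "c i = c' i"
  proof (cases "i < e")
    case True
    have "(\<Sum>i<e. sc (Poly_Mapping.single (\<alpha> - a i) (c i - c' i)) (\<epsilon> i)) = 0"
      using assms(3) by (simp add: elem_def single_diff scale_left_diff_distrib sum_subtractf)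
    then have "Poly_Mapping.single (\<alpha> - a i) (c i - c' i) = 0"
      by (rule basis_independent[OF _ True])
    then have "Poly_Mapping.lookup (Poly_Mapping.single (\<alpha> - a i) (c i - c' i)) (\<alpha> - a i) = 0"
      by simp
    then show ?thesis by simp
  next
    case False
    then have "c i = 0" "c' i = 0" using assms(1,2) by (auto simp: strand_def)
    then show ?thesis by simp
  qed
qed

lemma elem_zero [simp]: "elem \<alpha> 0 = 0"
  by (simp add: elem_def)

definition decomposition :: "'a \<Rightarrow> 'n mdeg set \<Rightarrow> ('n mdeg \<Rightarrow> nat \<Rightarrow> 'k) \<Rightarrow> bool" where
  "decomposition u A c \<longleftrightarrow>
     finite A \<and> (\<forall>\<alpha>. c \<alpha> \<in> strand e a \<alpha>) \<and> u = (\<Sum>\<alpha>\<in>A. elem \<alpha> (c \<alpha>))"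

text \<open>
  The component of degree \<open>\<alpha>\<close> collects, for each basis element, the term with exponent \<open>\<alpha> - a i\<close>
  of its polynomial coefficient.  A prescribed degree \<open>\<alpha>0\<close> can be added to the index set, so that
  comparing with an element of that degree needs no case distinction.
\<close>

lemma decompose:
  assumes "u \<in> underlying sc M"
  shows "\<exists>A c. \<alpha>0 \<in> A \<and> decomposition u A c"
proof -
  obtain q where q: "u = (\<Sum>i<e. sc (q i) (\<epsilon> i))" using assms underlying_iff by auto
  define A where "A = insert \<alpha>0 (\<Union>i<e. (\<lambda>\<beta>. a i + \<beta>) ` Poly_Mapping.keys (q i))"
  define c where
    "c \<alpha> i = (if i < e \<and> a i \<le> \<alpha> then Poly_Mapping.lookup (q i) (\<alpha> - a i) else 0)" for \<alpha> i
  have fin: "finite A" by (simp add: A_def)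
  have q_eq: "q i = (\<Sum>\<alpha>\<in>A. Poly_Mapping.single (\<alpha> - a i) (c \<alpha> i))" if i: "i < e" for i
  proof -
    let ?K = "Poly_Mapping.keys (q i)"
    have "(\<Sum>\<alpha>\<in>A. Poly_Mapping.single (\<alpha> - a i) (c \<alpha> i))
        = (\<Sum>\<alpha>\<in>(\<lambda>\<beta>. a i + \<beta>) ` ?K. Poly_Mapping.single (\<alpha> - a i) (c \<alpha> i))"
    proof (rule sum.mono_neutral_right[OF fin])
      show "(\<lambda>\<beta>. a i + \<beta>) ` ?K \<subseteq> A" using i by (auto simp: A_def)
      show "\<forall>\<alpha>\<in>A - (\<lambda>\<beta>. a i + \<beta>) ` ?K. Poly_Mapping.single (\<alpha> - a i) (c \<alpha> i) = 0"
      proof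
        fix \<alpha> assume \<alpha>: "\<alpha> \<in> A - (\<lambda>\<beta>. a i + \<beta>) ` ?K"
        have "c \<alpha> i = 0"
        proof (rule ccontr)
          assume "c \<alpha> i \<noteq> 0"
          then have "a i \<le> \<alpha>" "\<alpha> - a i \<in> ?K" by (auto simp: c_def in_keys_iff split: if_splits)
          then have "\<alpha> \<in> (\<lambda>\<beta>. a i + \<beta>) ` ?K" using mdeg_add_diff by (metis imageI)
          with \<alpha> show False by blast
        qed
        then show "Poly_Mapping.single (\<alpha> - a i) (c \<alpha> i) = 0" by simp
      qed
    qed
    also have "\<dots> = (\<Sum>\<beta>\<in>?K. Poly_Mapping.single (a i + \<beta> - a i) (c (a i + \<beta>) i))"
      by (subst sum.reindex) (auto intro!: inj_onI)
    also have "\<dots> = (\<Sum>\<beta>\<in>?K. Poly_Mapping.single \<beta> (Poly_Mapping.lookup (q i) \<beta>))"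
    proof (rule sum.cong[OF refl])
      fix \<beta>
      have "a i \<le> a i + \<beta>" "a i + \<beta> - a i = \<beta>" by (auto simp: le_fun_def)
      then show "Poly_Mapping.single (a i + \<beta> - a i) (c (a i + \<beta>) i)
          = Poly_Mapping.single \<beta> (Poly_Mapping.lookup (q i) \<beta>)"
        using i by (simp add: c_def)
    qed
    also have "\<dots> = q i" by (rule poly_mapping_sum_single[symmetric]) auto
    finally show ?thesis by simp
  qed
  have "u = (\<Sum>i<e. \<Sum>\<alpha>\<in>A. sc (Poly_Mapping.single (\<alpha> - a i) (c \<alpha> i)) (\<epsilon> i))"
    unfolding q
  proof (rule sum.cong[OF refl])
    fix i assume "i \<in> {..<e}"
    then have "q i = (\<Sum>\<alpha>\<in>A. Poly_Mapping.single (\<alpha> - a i) (c \<alpha> i))" by (intro q_eq) simp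
    then show "sc (q i) (\<epsilon> i) = (\<Sum>\<alpha>\<in>A. sc (Poly_Mapping.single (\<alpha> - a i) (c \<alpha> i)) (\<epsilon> i))"
      by (simp only: scale_sum_left)
  qed
  also have "\<dots> = (\<Sum>\<alpha>\<in>A. elem \<alpha> (c \<alpha>))" unfolding elem_def by (rule sum.swap)
  finally have "u = (\<Sum>\<alpha>\<in>A. elem \<alpha> (c \<alpha>))" .
  moreover have "\<alpha>0 \<in> A" by (simp add: A_def)
  moreover have "\<forall>\<alpha>. c \<alpha> \<in> strand e a \<alpha>" by (auto simp: c_def strand_def)
  ultimately show ?thesis using fin unfolding decomposition_def by (intro exI[of _ A] exI[of _ c]) simp
qed

text \<open>
  The sum of an element of \<open>M \<alpha>\<close> in terms of the basis splits into homogeneous parts, and by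
  independence of the components only the part of degree \<open>\<alpha>\<close> survives.
\<close>

lemma component_iff: "u \<in> M \<alpha> \<longleftrightarrow> (\<exists>c\<in>strand e a \<alpha>. u = elem \<alpha> c)"
proof
  assume u: "u \<in> M \<alpha>"
  then have "u \<in> underlying sc M" using subset_underlying by blast
  then obtain A c where "\<alpha> \<in> A" and "decomposition u A c"
    using decompose by blast
  then have A: "finite A" "\<alpha> \<in> A" and c: "\<forall>\<alpha>. c \<alpha> \<in> strand e a \<alpha>"
    and eq: "u = (\<Sum>\<alpha>\<in>A. elem \<alpha> (c \<alpha>))"
    by (auto simp: decomposition_def)
  have "u = elem \<alpha> (c \<alpha>)"
    by (rule component_eq[OF A(1) _ u eq A(2)]) (use c in \<open>simp add: elem_in\<close>)
  with c show "\<exists>c\<in>strand e a \<alpha>. u = elem \<alpha> c" by blast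
next
  assume "\<exists>c\<in>strand e a \<alpha>. u = elem \<alpha> c"
  then obtain c where "c \<in> strand e a \<alpha>" "u = elem \<alpha> c" ..
  then show "u \<in> M \<alpha>" using elem_in by metis
qed

end

section \<open>Graded maps and complexes in coordinates\<close>

locale based_map = src: based_module sc M e \<epsilon> a + tgt: based_module sc M' g \<gamma> b
  for sc :: "('n::finite, 'k::field, 'a::ab_group_add) scal"
    and M :: "('n, 'a) graded" and e \<epsilon> a and M' :: "('n, 'a) graded" and g \<gamma> b +
  fixes \<phi> :: "'a \<Rightarrow> 'a" and C :: "'k mat"
  assumes linear: "linear_between sc M M' \<phi>"
    and matrix: "coefficient_matrix sc \<phi> e \<epsilon> a g \<gamma> b C"
begin

lemma map_in: "u \<in> underlying sc M \<Longrightarrow> \<phi> u \<in> underlying sc M'"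
  using linear by (simp add: linear_between_def)

lemma map_scale: "u \<in> underlying sc M \<Longrightarrow> \<phi> (sc q u) = sc q (\<phi> u)"
  using linear by (simp add: linear_between_def)

lemma map_zero: "\<phi> 0 = 0"
  using map_scale[of 0 0] src.subset_underlying src.zero_in by (metis src.scale_zero_left subsetD)

lemma map_sum:
  "(\<And>x. x \<in> X \<Longrightarrow> h x \<in> underlying sc M) \<Longrightarrow> \<phi> (sum h X) = (\<Sum>x\<in>X. \<phi> (h x))"
proof (induction X rule: infinite_finite_induct)
  case (insert x X)
  then have "h x \<in> underlying sc M" "sum h X \<in> underlying sc M"
    by (auto intro: src.underlying_sum)
  then have "\<phi> (h x + sum h X) = \<phi> (h x) + \<phi> (sum h X)"
    using linear by (simp add: linear_between_def)
  with insert show ?case by simp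
qed (auto simp: map_zero)

lemma mat_apply_in: "c \<in> strand e a \<alpha> \<Longrightarrow> mat_apply C g e c \<in> strand g b \<alpha>"
  by (rule mat_apply_in_strand) (use matrix in \<open>auto simp: coefficient_matrix_def\<close>)

text \<open>
  The exponents add up, \<open>(\<alpha> - a j) + (a j - b i) = \<alpha> - b i\<close>, wherever the entry of the matrix and the
  coordinate are nonzero; where one of them vanishes, truncated subtraction does no harm.
\<close>

lemma map_elem:
  assumes c: "c \<in> strand e a \<alpha>"
  shows "\<phi> (src.elem \<alpha> c) = tgt.elem \<alpha> (mat_apply C g e c)"
proof -
  have eps: "\<epsilon> j \<in> underlying sc M" if "j < e" for j
    using src.basis_in[OF that] src.subset_underlying by blast
  have "sc q (\<epsilon> j) \<in> underlying sc M" if "j < e" for q j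
    using eps[OF that] unfolding underlying_def by (rule src.span_scale)
  then have "\<phi> (src.elem \<alpha> c) = (\<Sum>j<e. \<phi> (sc (Poly_Mapping.single (\<alpha> - a j) (c j)) (\<epsilon> j)))"
    unfolding src.elem_def by (intro map_sum) auto
  also have "\<dots> = (\<Sum>j<e. \<Sum>i<g. sc (Poly_Mapping.single (\<alpha> - b i) (C $$ (i, j) * c j)) (\<gamma> i))"
  proof (rule sum.cong[OF refl])
    fix j assume "j \<in> {..<e}"
    then have j: "j < e" by simp
    have "\<phi> (sc (Poly_Mapping.single (\<alpha> - a j) (c j)) (\<epsilon> j)) =
      (\<Sum>i<g. sc (Poly_Mapping.single ((\<alpha> - a j) + (a j - b i)) (c j * C $$ (i, j))) (\<gamma> i))"
      using matrix j
      by (simp add: map_scale[OF eps[OF j]] coefficient_matrix_def src.scale_sum_right mult_single)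
    also have "\<dots> = (\<Sum>i<g. sc (Poly_Mapping.single (\<alpha> - b i) (C $$ (i, j) * c j)) (\<gamma> i))"
    proof (rule sum.cong[OF refl])
      fix i assume "i \<in> {..<g}"
      then have i: "i < g" by simp
      show "sc (Poly_Mapping.single ((\<alpha> - a j) + (a j - b i)) (c j * C $$ (i, j))) (\<gamma> i)
          = sc (Poly_Mapping.single (\<alpha> - b i) (C $$ (i, j) * c j)) (\<gamma> i)"
      proof (cases "C $$ (i, j) * c j = 0")
        case False
        then have "b i \<le> a j" "a j \<le> \<alpha>"
          using matrix c i j by (auto simp: coefficient_matrix_def strand_def)
        then have "(\<alpha> - a j) + (a j - b i) = \<alpha> - b i" by (rule mdeg_diff_add_diff)
        then show ?thesis by (simp add: mult.commute)
      qed (auto simp: mult.commute)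
    qed
    finally show "\<phi> (sc (Poly_Mapping.single (\<alpha> - a j) (c j)) (\<epsilon> j)) = \<dots>" .
  qed
  also have "\<dots> = (\<Sum>i<g. \<Sum>j<e. sc (Poly_Mapping.single (\<alpha> - b i) (C $$ (i, j) * c j)) (\<gamma> i))"
    by (rule sum.swap)
  also have "\<dots> = tgt.elem \<alpha> (mat_apply C g e c)"
    unfolding tgt.elem_def
  proof (rule sum.cong[OF refl])
    fix i assume "i \<in> {..<g}"
    then have "Poly_Mapping.single (\<alpha> - b i) (mat_apply C g e c i)
        = (\<Sum>j<e. Poly_Mapping.single (\<alpha> - b i) (C $$ (i, j) * c j))"
      by (intro poly_mapping_eqI) (simp add: mat_apply_def lookup_sum lookup_single when_def)
    then show "(\<Sum>j<e. sc (Poly_Mapping.single (\<alpha> - b i) (C $$ (i, j) * c j)) (\<gamma> i))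
        = sc (Poly_Mapping.single (\<alpha> - b i) (mat_apply C g e c i)) (\<gamma> i)"
      by (simp only: src.scale_sum_left)
  qed
  finally show ?thesis .
qed

lemma map_graded: "\<phi> ` M \<alpha> \<subseteq> M' \<alpha>"
proof
  fix v assume "v \<in> \<phi> ` M \<alpha>"
  then obtain c where "c \<in> strand e a \<alpha>" "v = \<phi> (src.elem \<alpha> c)"
    using src.component_iff by auto
  then show "v \<in> M' \<alpha>" using map_elem tgt.elem_in mat_apply_in by metis
qed

lemma map_sum_elem:
  assumes "\<And>\<alpha>. \<alpha> \<in> A \<Longrightarrow> c \<alpha> \<in> strand e a \<alpha>"
  shows "\<phi> (\<Sum>\<alpha>\<in>A. src.elem \<alpha> (c \<alpha>)) = (\<Sum>\<alpha>\<in>A. tgt.elem \<alpha> (mat_apply C g e (c \<alpha>)))"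
proof -
  have "\<phi> (\<Sum>\<alpha>\<in>A. src.elem \<alpha> (c \<alpha>)) = (\<Sum>\<alpha>\<in>A. \<phi> (src.elem \<alpha> (c \<alpha>)))"
    using assms src.elem_in src.subset_underlying by (intro map_sum) blast
  also have "\<dots> = (\<Sum>\<alpha>\<in>A. tgt.elem \<alpha> (mat_apply C g e (c \<alpha>)))"
    by (rule sum.cong) (simp_all add: assms map_elem)
  finally show ?thesis .
qed

lemma map_elem_eq_zero_iff:
  "c \<in> strand e a \<alpha> \<Longrightarrow> \<phi> (src.elem \<alpha> c) = 0 \<longleftrightarrow> mat_apply C g e c = 0"
  using map_elem tgt.elem_inject[OF mat_apply_in zero_in_strand] by fastforce

end

text \<open>
  Over a domain, more than \<open>e\<close> combinations of the \<open>e\<close> images of the basis are dependent by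
  elimination.  This bound on the cardinalities is also what makes the maximum in the definition of \<open>map_rank\<close>
  meaningful, as it shows that their set is finite.
\<close>

lemma (in based_map) map_rank_le: "map_rank sc M \<phi> \<le> e"
proof -
  let ?X = "{card S | S. finite S \<and> S \<subseteq> \<phi> ` underlying sc M \<and> src.independent S}"
  have "card S \<le> e" if S: "finite S" "S \<subseteq> \<phi> ` underlying sc M" "src.independent S" for S
  proof (rule src.card_independent_in_finite_span[OF mpoly_no_zero_divisors S(1,3)])
    fix s assume "s \<in> S"
    then obtain u where u: "u \<in> underlying sc M" "s = \<phi> u" using S(2) by blast
    obtain q where q: "u = (\<Sum>j<e. sc (q j) (\<epsilon> j))" using u(1) src.underlying_iff by auto
    have eps: "\<epsilon> j \<in> underlying sc M" if "j < e" for j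
      using src.basis_in[OF that] src.subset_underlying by blast
    then have "sc (q j) (\<epsilon> j) \<in> underlying sc M" if "j < e" for j
      using that unfolding underlying_def by (simp add: src.span_scale)
    then have "s = (\<Sum>j<e. \<phi> (sc (q j) (\<epsilon> j)))" unfolding u q by (intro map_sum) simp
    also have "\<dots> = (\<Sum>j<e. sc (q j) (\<phi> (\<epsilon> j)))"
      by (rule sum.cong) (simp_all add: map_scale eps)
    finally show "\<exists>q. s = (\<Sum>j<e. sc (q j) (\<phi> (\<epsilon> j)))" by blast
  qed
  then have X: "?X \<subseteq> {..e}" by auto
  then have "finite ?X" by (rule finite_subset) simp
  moreover have "card ({} :: 'a set) \<in> ?X" using src.independent_empty by blast
  ultimately have "Max ?X \<in> ?X" by (intro Max_in) auto
  then show ?thesis using X unfolding map_rank_def by blast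
qed

text \<open>
  Multiples of a variable have no constant term, and the combinations of the basis whose coefficients
  have no constant term form a submodule.
\<close>

lemma (in based_module) variables_times_coefficient:
  assumes "(\<Sum>i<e. sc (q i) (\<epsilon> i)) \<in> variables_times sc M" "i < e"
  shows "Poly_Mapping.lookup (q i) 0 = 0"
proof -
  let ?V = "{v. \<exists>p. v = (\<Sum>i<e. sc (p i) (\<epsilon> i)) \<and> (\<forall>i<e. Poly_Mapping.lookup (p i) 0 = 0)}"
  have V0: "0 \<in> ?V"
  proof -
    have "0 = (\<Sum>i<e. sc 0 (\<epsilon> i)) \<and> (\<forall>i<e. Poly_Mapping.lookup (0 :: ('n, 'k) mpoly) 0 = 0)" by simp
    then show ?thesis by (intro CollectI exI[of _ "\<lambda>_. 0"])
  qed
  have V_add: "u + v \<in> ?V" if u: "u \<in> ?V" and v: "v \<in> ?V" for u v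
  proof -
    obtain p where "u = (\<Sum>i<e. sc (p i) (\<epsilon> i))" "\<forall>i<e. Poly_Mapping.lookup (p i) 0 = 0"
      using u by blast
    moreover obtain p' where "v = (\<Sum>i<e. sc (p' i) (\<epsilon> i))"
      "\<forall>i<e. Poly_Mapping.lookup (p' i) 0 = 0"
      using v by blast
    ultimately have "u + v = (\<Sum>i<e. sc (p i + p' i) (\<epsilon> i))
        \<and> (\<forall>i<e. Poly_Mapping.lookup (p i + p' i) 0 = 0)"
      by (simp add: scale_left_distrib sum.distrib lookup_add)
    then show ?thesis by (intro CollectI exI[of _ "\<lambda>i. p i + p' i"])
  qed
  have V_scale: "sc s v \<in> ?V" if v: "v \<in> ?V" for s v
  proof -
    obtain p where "v = (\<Sum>i<e. sc (p i) (\<epsilon> i))" "\<forall>i<e. Poly_Mapping.lookup (p i) 0 = 0"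
      using v by blast
    then have "sc s v = (\<Sum>i<e. sc (s * p i) (\<epsilon> i))
        \<and> (\<forall>i<e. Poly_Mapping.lookup (s * p i) 0 = 0)"
      by (simp add: scale_sum_right lookup_mult_zero)
    then show ?thesis by (intro CollectI exI[of _ "\<lambda>i. s * p i"])
  qed
  have "variables_times sc M \<subseteq> ?V"
    unfolding variables_times_def
  proof (rule span_minimal)
    show "subspace ?V" by (intro subspaceI V0 V_add V_scale)
    show "{sc (Poly_Mapping.single (\<lambda>j. if j = k then 1 else 0) 1) u | k u. u \<in> underlying sc M}
        \<subseteq> ?V"
    proof clarify
      fix k :: 'n and u assume "u \<in> underlying sc M"
      then obtain p where p: "u = (\<Sum>i<e. sc (p i) (\<epsilon> i))" using underlying_iff by auto
      let ?x = "Poly_Mapping.single (\<lambda>j. if j = k then 1 else 0) 1 :: ('n, 'k) mpoly"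
      have "(\<lambda>j. if j = k then 1 else 0) \<noteq> (0 :: 'n mdeg)" by (auto simp: fun_eq_iff)
      then have "Poly_Mapping.lookup ?x 0 = 0" by (simp add: lookup_single when_def)
      then have "Poly_Mapping.lookup (p i * ?x) 0 = 0" for i by (rule lookup_mult_zero)
      moreover have "sc ?x u = (\<Sum>i<e. sc (p i * ?x) (\<epsilon> i))"
        by (simp add: p scale_sum_right mult.commute)
      ultimately show "\<exists>p. sc ?x u = (\<Sum>i<e. sc (p i) (\<epsilon> i))
          \<and> (\<forall>i<e. Poly_Mapping.lookup (p i) 0 = 0)"
        by (intro exI[of _ "\<lambda>i. p i * ?x"]) simp
    qed
  qed
  then obtain p where p: "(\<Sum>i<e. sc (q i) (\<epsilon> i)) = (\<Sum>i<e. sc (p i) (\<epsilon> i))"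
    and p0: "\<forall>i<e. Poly_Mapping.lookup (p i) 0 = 0"
    using assms(1) by blast
  have "(\<Sum>i<e. sc (q i - p i) (\<epsilon> i)) = 0"
    using p by (simp add: scale_left_diff_distrib sum_subtractf)
  then have "q i - p i = 0" by (rule basis_independent[OF _ assms(2)])
  then show ?thesis using p0 assms(2) by simp
qed

text \<open>
  A nonzero entry between basis elements of equal degree would be a unit coefficient in the image of
  the map.
\<close>

lemma (in based_map) degree_neq_if_minimal:
  assumes "\<phi> ` underlying sc M \<subseteq> variables_times sc M'"
    and ij: "i < g" "j < e" and nz: "C $$ (i, j) \<noteq> 0"
  shows "b i \<noteq> a j"
proof
  assume eq: "b i = a j"
  have "\<epsilon> j \<in> underlying sc M" using src.basis_in[OF ij(2)] src.subset_underlying by blast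
  then have "\<phi> (\<epsilon> j) \<in> variables_times sc M'" using assms(1) by blast
  then have "(\<Sum>i<g. sc (Poly_Mapping.single (a j - b i) (C $$ (i, j))) (\<gamma> i)) \<in> variables_times sc M'"
    using matrix ij(2) by (simp add: coefficient_matrix_def)
  then have "Poly_Mapping.lookup (Poly_Mapping.single (a j - b i) (C $$ (i, j))) 0 = 0"
    using ij(1) by (rule tgt.variables_times_coefficient)
  moreover have "a j - b i = 0" by (simp add: eq fun_eq_iff)
  ultimately show False using nz by simp
qed

text \<open>
  Exactness at all homological degrees at least 1; the equivalence contains both inclusions, and in
  particular that the composites vanish.
\<close>

definition strands_exact ::
  "(nat \<Rightarrow> nat) \<Rightarrow> (nat \<Rightarrow> nat \<Rightarrow> 'n mdeg) \<Rightarrow> (nat \<Rightarrow> 'k::field mat) \<Rightarrow> bool" where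
  "strands_exact N \<delta> D \<longleftrightarrow> (\<forall>m \<alpha>. \<forall>c\<in>strand (N (Suc m)) (\<delta> (Suc m)) \<alpha>.
     mat_apply (D (Suc m)) (N m) (N (Suc m)) c = 0 \<longleftrightarrow>
     (\<exists>w\<in>strand (N (Suc (Suc m))) (\<delta> (Suc (Suc m))) \<alpha>.
        c = mat_apply (D (Suc (Suc m))) (N (Suc m)) (N (Suc (Suc m))) w))"

locale based_complex = Modules.module sc
  for sc :: "('n::finite, 'k::field, 'a::ab_group_add) scal" +
  fixes T :: "nat \<Rightarrow> ('n, 'a) graded" and d :: "nat \<Rightarrow> 'a \<Rightarrow> 'a"
    and N t \<delta> and D :: "nat \<Rightarrow> 'k mat"
  assumes T_graded: "multigraded_module sc (T m)"
    and T_basis: "homogeneous_basis sc (T m) (N m) (t m) (\<delta> m)"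
    and d_linear: "linear_between sc (T (Suc m)) (T m) (d (Suc m))"
    and d_matrix: "coefficient_matrix sc (d (Suc m)) (N (Suc m)) (t (Suc m)) (\<delta> (Suc m))
                     (N m) (t m) (\<delta> m) (D (Suc m))"
begin

lemma level: "based_module sc (T m) (N m) (t m) (\<delta> m)"
  by unfold_locales (auto intro: T_graded T_basis)

lemma differential: "based_map sc (T (Suc m)) (N (Suc m)) (t (Suc m)) (\<delta> (Suc m))
    (T m) (N m) (t m) (\<delta> m) (d (Suc m)) (D (Suc m))"
  by (intro based_map.intro based_map_axioms.intro level d_linear d_matrix)

text \<open>
  A cycle splits into homogeneous cycles, and a homogeneous boundary is the boundary of a component of
  the same degree.
\<close>

theorem exact_iff_strands_exact:
  "(\<forall>m. {u \<in> underlying sc (T (Suc m)). d (Suc m) u = 0}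
          = d (Suc (Suc m)) ` underlying sc (T (Suc (Suc m))))
   \<longleftrightarrow> strands_exact N \<delta> D"
proof -
  have "({u \<in> underlying sc (T (Suc m)). d (Suc m) u = 0}
          = d (Suc (Suc m)) ` underlying sc (T (Suc (Suc m))))
    \<longleftrightarrow> (\<forall>\<alpha>. \<forall>c\<in>strand (N (Suc m)) (\<delta> (Suc m)) \<alpha>.
     mat_apply (D (Suc m)) (N m) (N (Suc m)) c = 0 \<longleftrightarrow>
     (\<exists>w\<in>strand (N (Suc (Suc m))) (\<delta> (Suc (Suc m))) \<alpha>.
        c = mat_apply (D (Suc (Suc m))) (N (Suc m)) (N (Suc (Suc m))) w))" (is "?L \<longleftrightarrow> ?R")
    for m
  proof -
    interpret d1: based_map sc "T (Suc m)" "N (Suc m)" "t (Suc m)" "\<delta> (Suc m)"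
      "T m" "N m" "t m" "\<delta> m" "d (Suc m)" "D (Suc m)" by (rule differential)
    interpret d2: based_map sc "T (Suc (Suc m))" "N (Suc (Suc m))" "t (Suc (Suc m))"
      "\<delta> (Suc (Suc m))" "T (Suc m)" "N (Suc m)" "t (Suc m)" "\<delta> (Suc m)"
      "d (Suc (Suc m))" "D (Suc (Suc m))" by (rule differential)
    let ?S1 = "strand (N (Suc m)) (\<delta> (Suc m)) :: 'n mdeg \<Rightarrow> (nat \<Rightarrow> 'k) set"
    let ?S2 = "strand (N (Suc (Suc m))) (\<delta> (Suc (Suc m))) :: 'n mdeg \<Rightarrow> (nat \<Rightarrow> 'k) set"
    let ?D1 = "mat_apply (D (Suc m)) (N m) (N (Suc m))"
    let ?D2 = "mat_apply (D (Suc (Suc m))) (N (Suc m)) (N (Suc (Suc m)))"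
    show ?thesis
    proof
      assume L: ?L
      show ?R
      proof (intro allI ballI iffI)
        fix \<alpha> c assume c: "c \<in> ?S1 \<alpha>" and z: "?D1 c = 0"
        let ?u = "d1.src.elem \<alpha> c"
        have u: "?u \<in> T (Suc m) \<alpha>" using c by (rule d1.src.elem_in)
        moreover have "d (Suc m) ?u = 0" using d1.map_elem_eq_zero_iff[OF c] z by simp
        ultimately have "?u \<in> d (Suc (Suc m)) ` underlying sc (T (Suc (Suc m)))"
          using L d1.src.subset_underlying by blast
        then obtain v where v: "v \<in> underlying sc (T (Suc (Suc m)))" "?u = d (Suc (Suc m)) v"
          by blast
        obtain A w where "\<alpha> \<in> A" "d2.src.decomposition v A w"
          using d2.src.decompose[OF v(1)] by blast
        then have A: "finite A" "\<alpha> \<in> A" and w: "\<forall>\<beta>. w \<beta> \<in> ?S2 \<beta>"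
          and veq: "v = (\<Sum>\<beta>\<in>A. d2.src.elem \<beta> (w \<beta>))"
          by (auto simp: d2.src.decomposition_def)
        have eq: "?u = (\<Sum>\<beta>\<in>A. d1.src.elem \<beta> (?D2 (w \<beta>)))"
          unfolding v(2) veq by (rule d2.map_sum_elem) (simp add: w)
        have "?u = d1.src.elem \<alpha> (?D2 (w \<alpha>))"
          by (rule d1.src.component_eq[OF A(1) _ u eq A(2)])
            (simp add: w d1.src.elem_in d2.mat_apply_in)
        then have "c = ?D2 (w \<alpha>)"
          by (rule d1.src.elem_inject[OF c, rotated]) (use w in \<open>auto intro: d2.mat_apply_in\<close>)
        then show "\<exists>w\<in>?S2 \<alpha>. c = ?D2 w" using w by blast
      next
        fix \<alpha> c assume c: "c \<in> ?S1 \<alpha>" and "\<exists>w\<in>?S2 \<alpha>. c = ?D2 w"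
        then obtain w where w: "w \<in> ?S2 \<alpha>" "c = ?D2 w" by blast
        have "d2.src.elem \<alpha> w \<in> underlying sc (T (Suc (Suc m)))"
          using d2.src.elem_in[OF w(1)] d2.src.subset_underlying by blast
        then have "d (Suc m) (d (Suc (Suc m)) (d2.src.elem \<alpha> w)) = 0" using L by blast
        then show "?D1 c = 0"
          using d1.map_elem_eq_zero_iff[OF c] d2.map_elem[OF w(1)] w(2) by simp
      qed
    next
      assume R: ?R
      show ?L
      proof (intro equalityI subsetI)
        fix u assume "u \<in> {u \<in> underlying sc (T (Suc m)). d (Suc m) u = 0}"
        then have u: "u \<in> underlying sc (T (Suc m))" "d (Suc m) u = 0" by auto
        obtain A c where "d1.src.decomposition u A c"
          using d1.src.decompose[OF u(1)] by blast
        then have A: "finite A" and c: "\<forall>\<beta>. c \<beta> \<in> ?S1 \<beta>"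
          and ueq: "u = (\<Sum>\<beta>\<in>A. d1.src.elem \<beta> (c \<beta>))"
          by (auto simp: d1.src.decomposition_def)
        have sum0: "(\<Sum>\<beta>\<in>A. d1.tgt.elem \<beta> (?D1 (c \<beta>))) = 0"
          using d1.map_sum_elem[of A c] c u(2) ueq by simp
        have "\<exists>w. w \<in> ?S2 \<beta> \<and> c \<beta> = ?D2 w" if \<beta>: "\<beta> \<in> A" for \<beta>
        proof -
          have "d1.tgt.elem \<beta> (?D1 (c \<beta>)) = 0"
            by (rule d1.tgt.components_zero[OF A _ sum0 \<beta>])
              (simp add: c d1.tgt.elem_in d1.mat_apply_in)
          then have "?D1 (c \<beta>) = 0"
            using c d1.map_elem d1.map_elem_eq_zero_iff by metis
          then show ?thesis using R c by blast
        qed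
        then obtain w where w: "\<And>\<beta>. \<beta> \<in> A \<Longrightarrow> w \<beta> \<in> ?S2 \<beta>" "\<And>\<beta>. \<beta> \<in> A \<Longrightarrow> c \<beta> = ?D2 (w \<beta>)"
          by metis
        have "d (Suc (Suc m)) (\<Sum>\<beta>\<in>A. d2.src.elem \<beta> (w \<beta>))
            = (\<Sum>\<beta>\<in>A. d1.src.elem \<beta> (?D2 (w \<beta>)))"
          by (rule d2.map_sum_elem) (rule w(1))
        also have "\<dots> = u" unfolding ueq by (rule sum.cong) (simp_all add: w(2)[symmetric])
        finally have "u = d (Suc (Suc m)) (\<Sum>\<beta>\<in>A. d2.src.elem \<beta> (w \<beta>))" by simp
        moreover have "(\<Sum>\<beta>\<in>A. d2.src.elem \<beta> (w \<beta>)) \<in> underlying sc (T (Suc (Suc m)))"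
          using w(1) d2.src.elem_in d2.src.subset_underlying
          by (intro d2.src.underlying_sum) blast
        ultimately show "u \<in> d (Suc (Suc m)) ` underlying sc (T (Suc (Suc m)))" by blast
      next
        fix u assume "u \<in> d (Suc (Suc m)) ` underlying sc (T (Suc (Suc m)))"
        then obtain v where v: "v \<in> underlying sc (T (Suc (Suc m)))" "u = d (Suc (Suc m)) v"
          by blast
        obtain A w where "d2.src.decomposition v A w"
          using d2.src.decompose[OF v(1)] by blast
        then have w: "\<forall>\<beta>. w \<beta> \<in> ?S2 \<beta>"
          and veq: "v = (\<Sum>\<beta>\<in>A. d2.src.elem \<beta> (w \<beta>))"
          by (auto simp: d2.src.decomposition_def)
        have D2w: "?D2 (w \<beta>) \<in> ?S1 \<beta>" for \<beta> using w by (blast intro: d2.mat_apply_in)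
        then have D1: "?D1 (?D2 (w \<beta>)) = 0" for \<beta> using R w by blast
        have "u = (\<Sum>\<beta>\<in>A. d1.src.elem \<beta> (?D2 (w \<beta>)))"
          unfolding v(2) veq by (rule d2.map_sum_elem) (simp add: w)
        then have "d (Suc m) u = (\<Sum>\<beta>\<in>A. d1.tgt.elem \<beta> (?D1 (?D2 (w \<beta>))))"
          using d1.map_sum_elem[of A "\<lambda>\<beta>. ?D2 (w \<beta>)"] D2w by simp
        then have "d (Suc m) u = 0" by (simp add: D1)
        then show "u \<in> {u \<in> underlying sc (T (Suc m)). d (Suc m) u = 0}"
          using v d2.map_in by simp
      qed
    qed
  qed
  then show ?thesis unfolding strands_exact_def by simp
qed

end

section \<open>Multidegrees in a minimal resolution\<close>

text \<open>
  The combinatorial content of a minimal resolution of the cokernel of a map of uniform rank, expressed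
  through degrees and coefficient matrices alone.
\<close>

locale minimal_exact_strands =
  fixes N :: "nat \<Rightarrow> nat" and \<delta> :: "nat \<Rightarrow> nat \<Rightarrow> 'n::finite mdeg" and D :: "nat \<Rightarrow> 'k::field mat"
    and r :: nat
  assumes exact: "strands_exact N \<delta> D"
    and homogeneous: "i < N m \<Longrightarrow> j < N (Suc m) \<Longrightarrow> D (Suc m) $$ (i, j) \<noteq> 0 \<Longrightarrow>
      \<delta> m i \<le> \<delta> (Suc m) j"
    and minimal: "i < N (Suc m) \<Longrightarrow> j < N (Suc (Suc m)) \<Longrightarrow> D (Suc (Suc m)) $$ (i, j) \<noteq> 0 \<Longrightarrow>
      \<delta> (Suc m) i \<noteq> \<delta> (Suc (Suc m)) j"
    and few_columns_independent:
      "J \<subseteq> {..<N 1} \<Longrightarrow> card J \<le> r \<Longrightarrow> (\<And>i. c i \<noteq> 0 \<Longrightarrow> i \<in> J) \<Longrightarrow>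
       mat_apply (D 1) (N 0) (N 1) c = 0 \<Longrightarrow> c = 0"
begin

abbreviation differential :: "nat \<Rightarrow> (nat \<Rightarrow> 'k) \<Rightarrow> nat \<Rightarrow> 'k" where
  "differential m \<equiv> mat_apply (D (Suc m)) (N m) (N (Suc m))"

abbreviation degree_part :: "nat \<Rightarrow> 'n mdeg \<Rightarrow> (nat \<Rightarrow> 'k) set" where
  "degree_part m \<equiv> strand (N m) (\<delta> m)"

text \<open>
  The basis elements in homological degree 1 are called atoms, because the joins of their degrees make
  up the lcm-lattice.
\<close>

definition atoms_below :: "'n mdeg \<Rightarrow> nat set" where
  "atoms_below \<alpha> = {i. i < N 1 \<and> \<delta> 1 i \<le> \<alpha>}"

lemma atoms_below_mono: "\<alpha> \<le> \<beta> \<Longrightarrow> atoms_below \<alpha> \<subseteq> atoms_below \<beta>"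
  by (auto simp: atoms_below_def intro: order_trans)

lemma finite_atoms_below [simp]: "finite (atoms_below \<alpha>)"
  by (simp add: atoms_below_def)

lemma exactD:
  assumes "c \<in> degree_part (Suc m) \<alpha>" "differential m c = 0"
  shows "\<exists>w\<in>degree_part (Suc (Suc m)) \<alpha>. c = differential (Suc m) w"
  using exact assms unfolding strands_exact_def by blast

lemma differential_in: "c \<in> degree_part (Suc m) \<alpha> \<Longrightarrow> differential m c \<in> degree_part m \<alpha>"
  by (rule mat_apply_in_strand) (auto intro: homogeneous)

lemma differential_differential:
  "w \<in> degree_part (Suc (Suc m)) \<alpha> \<Longrightarrow> differential m (differential (Suc m) w) = 0"
  using exact differential_in unfolding strands_exact_def by blast

text \<open>
  This is where minimality enters.  A cycle \<open>z\<close> in the degree of the basis element \<open>j\<close> is a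
  boundary, and a basis element that contributes to its \<open>j\<close>-th coordinate would have exactly the
  degree of \<open>j\<close>; but no nonzero entry joins basis elements of equal degree.
\<close>

lemma cycle_coefficient_zero:
  assumes j: "j < N (Suc (Suc m))" and z: "z \<in> degree_part (Suc (Suc m)) (\<delta> (Suc (Suc m)) j)"
    and "differential (Suc m) z = 0"
  shows "z j = 0"
proof -
  obtain w where w: "w \<in> degree_part (Suc (Suc (Suc m))) (\<delta> (Suc (Suc m)) j)"
    and zw: "z = differential (Suc (Suc m)) w"
    using exactD assms(2,3) by blast
  have "D (Suc (Suc (Suc m))) $$ (j, l) * w l = 0" if l: "l < N (Suc (Suc (Suc m)))" for l
  proof (rule ccontr)
    assume *: "D (Suc (Suc (Suc m))) $$ (j, l) * w l \<noteq> 0"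
    then have "\<delta> (Suc (Suc m)) j \<le> \<delta> (Suc (Suc (Suc m))) l" using homogeneous j l by simp
    moreover have "\<delta> (Suc (Suc (Suc m))) l \<le> \<delta> (Suc (Suc m)) j"
      using w * by (simp add: strand_def)
    ultimately show False using minimal[OF j l] * by auto
  qed
  then have "(\<Sum>l<N (Suc (Suc (Suc m))). D (Suc (Suc (Suc m))) $$ (j, l) * w l) = 0"
    by (intro sum.neutral) simp
  then show ?thesis by (simp add: zw mat_apply_def)
qed

definition unit :: "nat \<Rightarrow> nat \<Rightarrow> 'k" where
  "unit j = (\<lambda>i. if i = j then 1 else 0)"

lemma unit_in: "j < N m \<Longrightarrow> unit j \<in> degree_part m (\<delta> m j)"
  by (simp add: unit_def strand_def)

text \<open>
  If at most \<open>r\<close> atoms were below the degree of \<open>j\<close>, then the boundary of \<open>j\<close> would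
  vanish: in homological degree 2 because at most \<open>r\<close> columns have no relations, and higher up because,
  by induction, the previous module has no basis element in that range.  So \<open>j\<close> would be a cycle with
  coordinate 1.
\<close>

lemma many_atoms_below:
  "j < N (Suc (Suc m)) \<Longrightarrow> r + 1 \<le> card (atoms_below (\<delta> (Suc (Suc m)) j))"
proof (induction m arbitrary: j rule: less_induct)
  case (less m)
  let ?\<alpha> = "\<delta> (Suc (Suc m)) j" and ?c = "differential (Suc m) (unit j)"
  have u: "unit j \<in> degree_part (Suc (Suc m)) ?\<alpha>" using less.prems by (rule unit_in)
  then have c: "?c \<in> degree_part (Suc m) ?\<alpha>" by (rule differential_in)
  show ?case
  proof (rule ccontr)
    assume "\<not> r + 1 \<le> card (atoms_below ?\<alpha>)"
    then have few: "card (atoms_below ?\<alpha>) \<le> r" by simp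
    have "?c = 0"
    proof (cases m)
      case 0
      have supp: "i \<in> atoms_below ?\<alpha>" if "?c i \<noteq> 0" for i
        using c that by (auto simp: strand_def atoms_below_def 0)
      show ?thesis
        by (rule few_columns_independent[of "atoms_below ?\<alpha>"])
          (use few supp differential_differential[OF u] in \<open>auto simp: atoms_below_def 0\<close>)
    next
      case (Suc n)
      have "?c i = 0" for i
      proof (rule ccontr)
        assume "?c i \<noteq> 0"
        then have i: "i < N (Suc (Suc n))" "\<delta> (Suc (Suc n)) i \<le> ?\<alpha>"
          using c by (auto simp: strand_def Suc)
        then have "r + 1 \<le> card (atoms_below (\<delta> (Suc (Suc n)) i))" using less.IH Suc by simp
        also have "\<dots> \<le> card (atoms_below ?\<alpha>)"
          using i(2) by (intro card_mono atoms_below_mono) auto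
        finally show False using few by simp
      qed
      then show ?thesis by (simp add: fun_eq_iff)
    qed
    then have "unit j j = 0" using cycle_coefficient_zero[OF less.prems u] by simp
    then show False by (simp add: unit_def)
  qed
qed

lemma atoms_below_nonempty: "j < N (Suc m) \<Longrightarrow> atoms_below (\<delta> (Suc m) j) \<noteq> {}"
proof (cases m)
  case 0
  then show "j < N (Suc m) \<Longrightarrow> ?thesis" by (auto simp: atoms_below_def)
next
  case (Suc n)
  then show "j < N (Suc m) \<Longrightarrow> ?thesis" using many_atoms_below[of j n] by auto
qed

lemma Sup_atoms_below_le:
  "atoms_below \<alpha> \<noteq> {} \<Longrightarrow> Sup_fin (\<delta> 1 ` atoms_below \<alpha>) \<le> \<alpha>"
  by (subst Sup_fin.bounded_iff) (auto simp: atoms_below_def)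

text \<open>
  By induction the boundary of \<open>j\<close> already lives in the degree of the join \<open>\<sigma>\<close>, so it is also the
  boundary of some \<open>w\<close> in degree \<open>\<sigma>\<close>.  The difference of \<open>j\<close> and \<open>w\<close> is a cycle, whose \<open>j\<close>-th
  coordinate has to vanish; hence \<open>j\<close> occurs in \<open>w\<close>, and its degree is at most \<open>\<sigma>\<close>.
\<close>

lemma degree_eq_Sup_atoms_below:
  "j < N (Suc m) \<Longrightarrow> \<delta> (Suc m) j = Sup_fin (\<delta> 1 ` atoms_below (\<delta> (Suc m) j))"
proof (induction m arbitrary: j)
  case 0
  then have "\<delta> 1 j \<le> Sup_fin (\<delta> 1 ` atoms_below (\<delta> 1 j))"
    by (intro Sup_fin.coboundedI) (auto simp: atoms_below_def)
  moreover have "Sup_fin (\<delta> 1 ` atoms_below (\<delta> 1 j)) \<le> \<delta> 1 j"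
    using atoms_below_nonempty[OF 0] by (intro Sup_atoms_below_le) simp
  ultimately show ?case by simp
next
  case (Suc m)
  let ?\<alpha> = "\<delta> (Suc (Suc m)) j" and ?c = "differential (Suc m) (unit j)"
  let ?\<sigma> = "Sup_fin (\<delta> 1 ` atoms_below ?\<alpha>)"
  have le: "?\<sigma> \<le> ?\<alpha>" using atoms_below_nonempty[OF Suc.prems] by (rule Sup_atoms_below_le)
  have u: "unit j \<in> degree_part (Suc (Suc m)) ?\<alpha>" using Suc.prems by (rule unit_in)
  then have c: "?c \<in> degree_part (Suc m) ?\<alpha>" by (rule differential_in)
  have "\<delta> (Suc m) i \<le> ?\<sigma>" if "?c i \<noteq> 0" for i
  proof -
    have i: "i < N (Suc m)" "\<delta> (Suc m) i \<le> ?\<alpha>" using c that by (auto simp: strand_def)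
    have "\<delta> (Suc m) i = Sup_fin (\<delta> 1 ` atoms_below (\<delta> (Suc m) i))" using i(1) by (rule Suc.IH)
    also have "\<dots> \<le> ?\<sigma>"
      using atoms_below_mono[OF i(2)] atoms_below_nonempty[OF i(1)]
      by (intro Sup_fin.subset_imp) auto
    finally show ?thesis .
  qed
  then have "?c \<in> degree_part (Suc m) ?\<sigma>" using c by (auto simp: strand_def)
  then obtain w where w: "w \<in> degree_part (Suc (Suc m)) ?\<sigma>" "?c = differential (Suc m) w"
    using exactD differential_differential[OF u] by blast
  have "w \<in> degree_part (Suc (Suc m)) ?\<alpha>"
    using w(1) le unfolding strand_def by (blast intro: order_trans)
  then have "unit j - w \<in> degree_part (Suc (Suc m)) ?\<alpha>" by (rule diff_in_strand[OF u])
  moreover have "differential (Suc m) (unit j - w) = 0" using w(2) by (simp add: mat_apply_diff)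
  ultimately have "(unit j - w) j = 0" by (rule cycle_coefficient_zero[OF Suc.prems])
  then have "w j \<noteq> 0" by (simp add: unit_def)
  then have "?\<alpha> \<le> ?\<sigma>" using w(1) by (simp add: strand_def)
  then show ?case using le by (rule antisym)
qed

end

section \<open>Relabeling by a map preserving large joins\<close>

locale join_preserving_relabeling = minimal_exact_strands +
  fixes f :: "'a mdeg \<Rightarrow> 'm::finite mdeg"
  assumes f_join: "I \<subseteq> {..<N 1} \<Longrightarrow> r + 1 \<le> card I \<Longrightarrow>
    f (Sup_fin (\<delta> 1 ` I)) = Sup_fin ((\<lambda>i. f (\<delta> 1 i)) ` I)"
begin

lemma f_le_iff:
  assumes "I \<subseteq> {..<N 1}" "r + 1 \<le> card I"
  shows "f (Sup_fin (\<delta> 1 ` I)) \<le> \<beta> \<longleftrightarrow> (\<forall>i\<in>I. f (\<delta> 1 i) \<le> \<beta>)"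
proof -
  have "finite I" "I \<noteq> {}" using assms finite_subset by auto
  then show ?thesis using f_join[OF assms] by (simp add: Sup_fin.bounded_iff)
qed

text \<open>
  The degree of \<open>j\<close> is the join of the degrees of more than \<open>r\<close> atoms, and such joins are
  preserved by \<open>f\<close>.
\<close>

lemma f_degree_le_iff:
  assumes "j < N (Suc (Suc m))"
  shows "f (\<delta> (Suc (Suc m)) j) \<le> \<beta>
    \<longleftrightarrow> (\<forall>i\<in>atoms_below (\<delta> (Suc (Suc m)) j). f (\<delta> 1 i) \<le> \<beta>)"
  using f_le_iff[OF _ many_atoms_below[OF assms]] degree_eq_Sup_atoms_below[OF assms]
  by (simp add: atoms_below_def subset_eq)

lemma f_homogeneous:
  assumes i: "i < N (Suc m)" and j: "j < N (Suc (Suc m))"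
    and nz: "D (Suc (Suc m)) $$ (i, j) \<noteq> 0"
  shows "f (\<delta> (Suc m) i) \<le> f (\<delta> (Suc (Suc m)) j)"
proof -
  have sub: "atoms_below (\<delta> (Suc m) i) \<subseteq> atoms_below (\<delta> (Suc (Suc m)) j)"
    using homogeneous[OF i j nz] by (rule atoms_below_mono)
  have *: "\<forall>k\<in>atoms_below (\<delta> (Suc (Suc m)) j). f (\<delta> 1 k) \<le> f (\<delta> (Suc (Suc m)) j)"
    using f_degree_le_iff[OF j] by blast
  show ?thesis
  proof (cases m)
    case 0
    then have "i \<in> atoms_below (\<delta> (Suc m) i)" using i by (simp add: atoms_below_def)
    then show ?thesis using sub * 0 by auto
  next
    case (Suc n)
    then show ?thesis using f_degree_le_iff i sub * by blast
  qed
qed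

text \<open>
  Only the kernel of the first matrix matters, since exactness is not claimed in homological degree 0;
  so the target of the presentation may change along with its matrix.
\<close>

theorem relabeled_strands_exact:
  assumes N': "\<And>m. N' (Suc m) = N (Suc m)"
    and \<delta>': "\<And>m i. i < N (Suc m) \<Longrightarrow> \<delta>' (Suc m) i = f (\<delta> (Suc m) i)"
    and D': "\<And>m. D' (Suc (Suc m)) = D (Suc (Suc m))"
    and kernel: "\<And>c. mat_apply (D' 1) (N' 0) (N 1) c = 0 \<longleftrightarrow> mat_apply (D 1) (N 0) (N 1) c = 0"
  shows "strands_exact N' \<delta>' D'"
proof -
  have zero_iff: "mat_apply (D' (Suc m)) (N' m) (N' (Suc m)) c = 0 \<longleftrightarrow> differential m c = 0" for m c
    by (cases m) (use kernel in \<open>simp_all add: N' D'\<close>)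
  have strand': "strand (N' (Suc m)) (\<delta>' (Suc m)) \<beta> = strand (N (Suc m)) (\<lambda>i. f (\<delta> (Suc m) i)) \<beta>"
    for m \<beta>
    using \<delta>' by (auto simp: strand_def N')
  have "\<forall>c\<in>strand (N (Suc m)) (\<lambda>i. f (\<delta> (Suc m) i)) \<beta>. differential m c = 0 \<longleftrightarrow>
     (\<exists>w\<in>strand (N (Suc (Suc m))) (\<lambda>i. f (\<delta> (Suc (Suc m)) i)) \<beta>. c = differential (Suc m) w)"
    for m \<beta>
  proof -
    \<comment> \<open>\<open>J\<close> is either large enough for \<open>f\<close> to preserve its join, or so small that the strand is trivial.\<close>
    define J where "J = {i. i < N 1 \<and> f (\<delta> 1 i) \<le> \<beta>}"
    have J: "J \<subseteq> {..<N 1}" "finite J" by (auto simp: J_def)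
    have f_le: "f (\<delta> (Suc (Suc m)) i) \<le> \<beta> \<longleftrightarrow> atoms_below (\<delta> (Suc (Suc m)) i) \<subseteq> J"
      if "i < N (Suc (Suc m))" for m i
      unfolding f_degree_le_iff[OF that] by (auto simp: J_def atoms_below_def)
    show ?thesis
    proof (cases "r + 1 \<le> card J")
      case True
      define \<alpha> where "\<alpha> = Sup_fin (\<delta> 1 ` J)"
      have "J \<noteq> {}" using True by auto
      have J_sub: "J \<subseteq> atoms_below \<alpha>"
        using J unfolding \<alpha>_def atoms_below_def by (auto intro: Sup_fin.coboundedI)
      have card: "r + 1 \<le> card (atoms_below \<alpha>)"
        using True card_mono[OF finite_atoms_below J_sub] by simp
      have "Sup_fin (\<delta> 1 ` atoms_below \<alpha>) = \<alpha>"
      proof (rule antisym)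
        show "Sup_fin (\<delta> 1 ` atoms_below \<alpha>) \<le> \<alpha>"
          using J_sub \<open>J \<noteq> {}\<close> by (intro Sup_atoms_below_le) auto
        show "\<alpha> \<le> Sup_fin (\<delta> 1 ` atoms_below \<alpha>)"
          unfolding \<alpha>_def using J_sub \<open>J \<noteq> {}\<close>
          by (intro Sup_fin.subset_imp) (auto simp: \<alpha>_def)
      qed
      moreover have "f \<alpha> \<le> \<beta>"
        unfolding \<alpha>_def f_le_iff[OF J(1) True] by (simp add: J_def)
      moreover have "atoms_below \<alpha> \<subseteq> {..<N 1}" by (auto simp: atoms_below_def)
      ultimately have "\<forall>i\<in>atoms_below \<alpha>. f (\<delta> 1 i) \<le> \<beta>" using f_le_iff[OF _ card] by simp
      \<comment> \<open>Both sets have the join \<open>\<alpha>\<close> and \<open>f\<close> preserves both joins, so \<open>f (\<delta> 1 i) \<le> f \<alpha> \<le> \<beta>\<close>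
        for every \<open>i\<close> with \<open>\<delta> 1 i \<le> \<alpha>\<close>.\<close>
      then have J_eq: "J = atoms_below \<alpha>" using J_sub by (auto simp: J_def atoms_below_def)
      have "f (\<delta> (Suc m) i) \<le> \<beta> \<longleftrightarrow> \<delta> (Suc m) i \<le> \<alpha>" if i: "i < N (Suc m)" for m i
      proof (cases m)
        case 0
        then show ?thesis using i J_eq by (auto simp: J_def atoms_below_def)
      next
        case (Suc n)
        have "atoms_below (\<delta> (Suc m) i) \<subseteq> J \<longleftrightarrow> \<delta> (Suc m) i \<le> \<alpha>"
        proof
          assume "atoms_below (\<delta> (Suc m) i) \<subseteq> J"
          then have "Sup_fin (\<delta> 1 ` atoms_below (\<delta> (Suc m) i)) \<le> \<alpha>"
            unfolding \<alpha>_def using J(2) atoms_below_nonempty[OF i] by (intro Sup_fin.subset_imp) auto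
          then show "\<delta> (Suc m) i \<le> \<alpha>" using degree_eq_Sup_atoms_below[OF i] by simp
        next
          assume "\<delta> (Suc m) i \<le> \<alpha>"
          then show "atoms_below (\<delta> (Suc m) i) \<subseteq> J" unfolding J_eq by (rule atoms_below_mono)
        qed
        then show ?thesis using f_le i Suc by simp
      qed
      then have "strand (N (Suc m)) (\<lambda>i. f (\<delta> (Suc m) i)) \<beta> = degree_part (Suc m) \<alpha>" for m
        by (auto simp: strand_def)
      then show ?thesis using exact unfolding strands_exact_def by simp
    next
      case False
      have "strand (N (Suc (Suc m))) (\<lambda>i. f (\<delta> (Suc (Suc m)) i)) \<beta>
          = {0 :: nat \<Rightarrow> 'b}" for m
      proof -
        have "\<not> f (\<delta> (Suc (Suc m)) i) \<le> \<beta>" if i: "i < N (Suc (Suc m))" for i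
        proof
          assume "f (\<delta> (Suc (Suc m)) i) \<le> \<beta>"
          then have "atoms_below (\<delta> (Suc (Suc m)) i) \<subseteq> J" by (simp only: f_le[OF i])
          with J(2) have "card (atoms_below (\<delta> (Suc (Suc m)) i)) \<le> card J" by (rule card_mono)
          then show False using many_atoms_below[OF i] False by simp
        qed
        then have "c i = 0" if "c \<in> strand (N (Suc (Suc m))) (\<lambda>i. f (\<delta> (Suc (Suc m)) i)) \<beta>" for c :: "nat \<Rightarrow> 'b" and i
          using that by (auto simp: strand_def)
        then show ?thesis by (auto simp: fun_eq_iff zero_in_strand)
      qed
      moreover have "c = 0"
        if c: "c \<in> strand (N (Suc 0)) (\<lambda>i. f (\<delta> (Suc 0) i)) \<beta>" and "differential 0 c = 0" for c
      proof (rule few_columns_independent[OF J(1)])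
        show "card J \<le> r" using False by simp
        show "i \<in> J" if "c i \<noteq> 0" for i using c that by (auto simp: strand_def J_def)
        show "mat_apply (D 1) (N 0) (N 1) c = 0" using that by simp
      qed
      ultimately show ?thesis by (cases m) auto
    qed
  qed
  then show ?thesis
    unfolding strands_exact_def strand' zero_iff by (simp add: N' D')
qed

end

section \<open>Coefficient matrices and their columns\<close>

text \<open>
  A repeated column leaves fewer than \<open>nc\<close> vectors to span the column space.
\<close>

lemma (in vec_space) distinct_cols_if_full_rank:
  assumes A: "A \<in> carrier_mat n nc" and "rank A = nc"
  shows "distinct (cols A)"
proof -
  obtain S where S: "maximal S (\<lambda>T. T \<subseteq> set (cols A) \<and> lin_indpt T)"
    using maximal_exists[of "(\<lambda>T. T \<subseteq> set (cols A) \<and> lin_indpt T)" "card (set (cols A))" "{}"]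
    by (meson List.finite_set card_mono empty_iff empty_subsetI finite_lin_indpt2 rev_finite_subset)
  then have "card S \<le> card (set (cols A))" by (simp add: card_mono maximal_def)
  then have "length (cols A) \<le> card (set (cols A))"
    using rank_card_indpt[OF A S] assms by simp
  then show ?thesis using card_length card_distinct le_antisym by metis
qed

lemma mat_apply_conv_mult_mat_vec:
  assumes "C \<in> carrier_mat g e" "i < g"
  shows "mat_apply C g e c i = (C *\<^sub>v vec e c) $ i"
  using assms by (simp add: mat_apply_def scalar_prod_def atLeast0LessThan)

lemma mat_apply_eq_zero_iff:
  assumes "C \<in> carrier_mat g e"
  shows "mat_apply C g e c = 0 \<longleftrightarrow> C *\<^sub>v vec e c = 0\<^sub>v g"
proof
  assume "mat_apply C g e c = 0"
  then show "C *\<^sub>v vec e c = 0\<^sub>v g"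
    using mat_apply_conv_mult_mat_vec[OF assms, of _ c] by (intro eq_vecI) (use assms in auto)
next
  assume *: "C *\<^sub>v vec e c = 0\<^sub>v g"
  have "mat_apply C g e c i = 0" for i
  proof (cases "i < g")
    case True
    then show ?thesis using mat_apply_conv_mult_mat_vec[OF assms True] * by simp
  qed (simp add: mat_apply_def)
  then show "mat_apply C g e c = 0" by (simp add: fun_eq_iff)
qed

text \<open>
  At most \<open>r\<close> columns can be completed to \<open>r\<close> columns because \<open>r \<le> e\<close>.  Reindexing the columns of the
  submatrix along \<open>pick J\<close> turns a relation between these columns of \<open>C\<close> into one between the columns of
  the submatrix.
\<close>

lemma columns_independent_if_uniform_rank:
  assumes C: "C \<in> carrier_mat g e" and "r \<le> e"
    and rk: "\<forall>J\<subseteq>{..<e}. card J = r \<longrightarrow> vec_space.rank g (submatrix C UNIV J) = r"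
    and J0: "J0 \<subseteq> {..<e}" "card J0 \<le> r" and supp: "\<And>j. c j \<noteq> 0 \<Longrightarrow> j \<in> J0"
    and zero: "mat_apply C g e c = 0"
  shows "c = 0"
proof -
  obtain J where J: "J0 \<subseteq> J" "J \<subseteq> {..<e}" "card J = r"
    using exists_subset_between[of J0 r "{..<e}"] J0 \<open>r \<le> e\<close> by auto
  have [simp]: "finite J" using J(2) finite_subset by blast
  have card_J: "card {j. j < e \<and> j \<in> J} = r"
    using J(2,3) by (metis (no_types, lifting) Collect_cong Collect_mem_eq lessThan_iff subsetD)
  let ?A = "submatrix C UNIV J"
  have A: "?A \<in> carrier_mat g r"
    using C card_J by (intro carrier_matI) (simp_all add: dim_submatrix)
  have A_index: "?A $$ (i, k) = C $$ (i, pick J k)" if "i < g" "k < r" for i k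
    using that C card_J by (subst submatrix_index) (simp_all add: pick_UNIV)
  have bij: "bij_betw (pick J) {..<r} J"
  proof (rule bij_betw_imageI)
    show inj: "inj_on (pick J) {..<r}"
      by (intro inj_onI) (metis J(3) lessThan_iff pick_eq_iff_inf pick_mono_le linorder_neqE_nat order_less_irrefl)
    have "pick J ` {..<r} \<subseteq> J" using J(3) pick_in_set_le by auto
    then show "pick J ` {..<r} = J"
      by (rule card_subset_eq[OF \<open>finite J\<close>]) (simp add: card_image[OF inj] J(3))
  qed
  let ?v = "vec r (\<lambda>k. c (pick J k))"
  have "?A *\<^sub>v ?v = 0\<^sub>v g"
  proof (rule eq_vecI)
    fix i assume "i < dim_vec (0\<^sub>v g :: 'a vec)"
    then have i: "i < g" by simp
    have "(?A *\<^sub>v ?v) $ i = (\<Sum>k<r. C $$ (i, pick J k) * c (pick J k))"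
      using A i by (simp add: scalar_prod_def atLeast0LessThan A_index)
    also have "\<dots> = (\<Sum>j\<in>J. C $$ (i, j) * c j)" by (rule sum.reindex_bij_betw[OF bij])
    also have "\<dots> = (\<Sum>j<e. C $$ (i, j) * c j)"
      by (rule sum.mono_neutral_left) (use J supp in auto)
    also have "\<dots> = mat_apply C g e c i" using i by (simp add: mat_apply_def)
    finally show "(?A *\<^sub>v ?v) $ i = 0\<^sub>v g $ i" using zero i by simp
  qed (use A in auto)
  moreover have "vec_space.rank g ?A = r" using rk J by blast
  ultimately have v0: "?v = 0\<^sub>v r"
    using vec_space.lin_depI[OF A] vec_space.full_rank_lin_indpt[OF A]
      vec_space.distinct_cols_if_full_rank[OF A] vec_carrier by blast
  have "c j = 0" for j
  proof (rule ccontr)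
    assume "c j \<noteq> 0"
    then have "j \<in> pick J ` {..<r}" using supp J(1) bij by (auto simp: bij_betw_def)
    then obtain k where k: "k < r" "j = pick J k" by auto
    then have "c j = ?v $ k" by simp
    also have "\<dots> = 0" using k(1) by (simp only: v0 index_zero_vec)
    finally show False using \<open>c j \<noteq> 0\<close> by simp
  qed
  then show ?thesis by (simp add: fun_eq_iff)
qed

text \<open>
  The columns of \<open>B\<close> are independent, so \<open>B\<close> can be cancelled on the left.
\<close>

lemma image_basis_kernel:
  assumes B: "image_basis C B" and A: "A \<in> carrier_mat (dim_col B) e" and C: "C \<in> carrier_mat g e"
    "C = B * A" and v: "v \<in> carrier_vec e"
  shows "C *\<^sub>v v = 0\<^sub>v g \<longleftrightarrow> A *\<^sub>v v = 0\<^sub>v (dim_col B)"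
proof -
  have Bc: "B \<in> carrier_mat g (dim_col B)" using B C by (auto simp: image_basis_def)
  have dist: "distinct (cols B)" using B by (simp add: image_basis_def)
  have ind: "\<not> LinearCombinations.module.lin_dep class_ring (module_vec TYPE('a) g) (set (cols B))"
    using B C by (auto simp: image_basis_def)
  have Cv: "C *\<^sub>v v = B *\<^sub>v (A *\<^sub>v v)" unfolding C(2) by (rule assoc_mult_mat_vec[OF Bc A v])
  have Av: "A *\<^sub>v v \<in> carrier_vec (dim_col B)" using A v by simp
  show ?thesis
  proof
    assume "C *\<^sub>v v = 0\<^sub>v g"
    then have zero: "B *\<^sub>v (A *\<^sub>v v) = 0\<^sub>v g" by (simp only: Cv)
    show "A *\<^sub>v v = 0\<^sub>v (dim_col B)"
    proof (rule ccontr)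
      assume "A *\<^sub>v v \<noteq> 0\<^sub>v (dim_col B)"
      from vec_space.lin_depI[OF Bc Av this zero dist] ind show False by contradiction
    qed
  next
    assume "A *\<^sub>v v = 0\<^sub>v (dim_col B)"
    then have "C *\<^sub>v v = B *\<^sub>v 0\<^sub>v (dim_col B)" by (simp only: Cv)
    also have "\<dots> = 0\<^sub>v g"
      using carrier_matD(1)[OF Bc] by (intro eq_vecI) (simp_all add: scalar_prod_def)
    finally show "C *\<^sub>v v = 0\<^sub>v g" .
  qed
qed

section \<open>The relabeled resolution\<close>

theorem theorem7p2:
  fixes sc :: "('n::finite, 'k::field, 'a::ab_group_add) scal"
    and sc' :: "('m::finite, 'k, 'b::ab_group_add) scal"
    and E G :: "('n, 'a) graded" and E' G' :: "('m, 'b) graded"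
    and f :: "'n mdeg \<Rightarrow> 'm mdeg" and r :: nat
  assumes "Modules.module sc" and "Modules.module sc'"
    and "finite_free sc E" and "finite_free sc G" and "multigraded_map sc E G \<phi>"
    and "finite_free sc' E'" and "finite_free sc' G'" and "multigraded_map sc' E' G' \<phi>'"
    and "QE_structure sc E G \<phi> sc' E' G' \<phi>' e \<epsilon> a \<epsilon>' a' g \<gamma> b C g' \<gamma>' b' C' B B'"
    and "uniform_rank sc E \<phi> C r" and "uniform_rank sc' E' \<phi>' C' r"
    and "f \<in> lcm_lattice e a \<rightarrow> lcm_lattice e a'"
    and "\<forall>i<e. f (a i) = a' i"
    and "\<forall>I\<subseteq>{..<e}. card I \<ge> r + 1 \<longrightarrow> f (Sup_fin (a ` I)) = Sup_fin ((\<lambda>i. f (a i)) ` I)"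
    and "minimal_free_resolution_coker sc F d E G \<phi>"
    and "F 0 = G" and "F 1 = E" and "\<forall>u\<in>underlying sc E. d 1 u = \<phi> u"
    and "complex_bases sc F d N t \<delta> D" and "N 1 = e" and "t 1 = \<epsilon>" and "\<delta> 1 = a"
  shows "relabelable f (lcm_lattice e a) N \<delta> D \<and>
    (\<forall>T' d'. relabeled f N \<delta> D sc' E' G' \<phi>' \<epsilon>' T' d' \<longrightarrow>
       free_resolution_coker sc' T' d' E' G' \<phi>')"
proof -
  interpret Q: Modules.module sc by fact
  interpret Q': Modules.module sc' by fact
  have E_basis: "homogeneous_basis sc E e \<epsilon> a" and G_basis: "homogeneous_basis sc G g \<gamma> b"
    and C_matrix: "coefficient_matrix sc \<phi> e \<epsilon> a g \<gamma> b C"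
    and E'_basis: "homogeneous_basis sc' E' e \<epsilon>' a'" and G'_basis: "homogeneous_basis sc' G' g' \<gamma>' b'"
    and C'_matrix: "coefficient_matrix sc' \<phi>' e \<epsilon>' a' g' \<gamma>' b' C'"
    and B: "image_basis C B" and B': "image_basis C' B'" and dim_B: "dim_col B = dim_col B'"
    using assms(9) by (auto simp: QE_structure_def presented_by_def)
  obtain A where A: "A \<in> carrier_mat (dim_col B) e" "C = B * A" "C' = B' * A"
    using assms(9) by (auto simp: QE_structure_def)
  have C: "C \<in> carrier_mat g e" and C': "C' \<in> carrier_mat g' e"
    using C_matrix C'_matrix by (auto simp: coefficient_matrix_def)
  have kernel: "mat_apply C' g' e c = 0 \<longleftrightarrow> mat_apply C g e c = 0" for c
    unfolding mat_apply_eq_zero_iff[OF C] mat_apply_eq_zero_iff[OF C']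
    using image_basis_kernel[OF B A(1) C A(2)] image_basis_kernel[OF B' _ C' A(3)] A(1) dim_B
    by simp
  have graded: "multigraded_module sc E" "multigraded_module sc G"
    "multigraded_module sc' E'" "multigraded_module sc' G'"
    using assms(3,4,6,7) by (auto simp: finite_free_def)

  have res: "free_resolution_coker sc F d E G \<phi>"
    and min: "\<And>m. d (Suc m) ` underlying sc (F (Suc m)) \<subseteq> variables_times sc (F m)"
    using assms(15) by (auto simp: minimal_free_resolution_coker_def)
  have F_complex: "multigraded_complex sc F d"
    and F_exact: "\<forall>m. {u \<in> underlying sc (F (Suc m)). d (Suc m) u = 0}
        = d (Suc (Suc m)) ` underlying sc (F (Suc (Suc m)))"
    using res by (auto simp: free_resolution_coker_def)
  \<comment> \<open>The data of the resolution are given from homological degree 1 on; the basis of \<open>G\<close> and the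
    coefficient matrix of \<open>\<phi>\<close> complete them.\<close>
  define N0 t0 \<delta>0 D0 where "N0 = N(0 := g)" and "t0 = t(0 := \<gamma>)" and "\<delta>0 = \<delta>(0 := b)"
    and "D0 = D(Suc 0 := C)"
  note zero_defs = N0_def t0_def \<delta>0_def D0_def
  have F_based: "based_complex sc F d N0 t0 \<delta>0 D0"
  proof (intro based_complex.intro based_complex_axioms.intro Q.module_axioms)
    fix m
    show "multigraded_module sc (F m)"
      using F_complex by (simp add: multigraded_complex_def finite_free_def)
    show "homogeneous_basis sc (F m) (N0 m) (t0 m) (\<delta>0 m)"
      using G_basis assms(16,19) by (cases m) (simp_all add: zero_defs complex_bases_def)
    show "linear_between sc (F (Suc m)) (F m) (d (Suc m))"
      using F_complex by (simp add: multigraded_complex_def multigraded_map_def)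
    show "coefficient_matrix sc (d (Suc m)) (N0 (Suc m)) (t0 (Suc m)) (\<delta>0 (Suc m))
        (N0 m) (t0 m) (\<delta>0 m) (D0 (Suc m))"
    proof (cases m)
      case 0
      interpret E: based_module sc E e \<epsilon> a
        by (intro based_module.intro based_module_axioms.intro Q.module_axioms graded E_basis)
      have "d (Suc 0) (\<epsilon> j) = \<phi> (\<epsilon> j)" if "j < e" for j
        using assms(18) E.basis_in[OF that] E.subset_underlying by auto
      then show ?thesis
        using C_matrix assms(20-22) by (simp add: 0 zero_defs coefficient_matrix_def)
    next
      case (Suc n)
      then show ?thesis using assms(19) by (simp add: zero_defs complex_bases_def)
    qed
  qed
  interpret F: based_complex sc F d N0 t0 \<delta>0 D0 by (rule F_based)
  have phi: "based_map sc E e \<epsilon> a G g \<gamma> b \<phi> C"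
    using assms(5) E_basis G_basis C_matrix graded
    by (intro based_map.intro based_map_axioms.intro based_module.intro based_module_axioms.intro
        Q.module_axioms) (auto simp: multigraded_map_def)
  \<comment> \<open>If \<open>r > e\<close>, uniform rank would say nothing about the columns.\<close>
  have r_le: "r \<le> e"
    using based_map.map_rank_le[OF phi] assms(10) by (simp add: uniform_rank_def)
  have rank: "\<forall>J\<subseteq>{..<e}. card J = r \<longrightarrow> vec_space.rank g (submatrix C UNIV J) = r"
    using assms(10) C by (simp add: uniform_rank_def)
  have join: "f (Sup_fin (a ` I)) = Sup_fin ((\<lambda>i. f (a i)) ` I)"
    if "I \<subseteq> {..<e}" "r + 1 \<le> card I" for I
    using assms(14) that by blast
  interpret R: join_preserving_relabeling N0 \<delta>0 D0 r f
  proof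
    show "strands_exact N0 \<delta>0 D0" using F.exact_iff_strands_exact F_exact by simp
  next
    fix i m j assume "i < N0 m" "j < N0 (Suc m)" "D0 (Suc m) $$ (i, j) \<noteq> 0"
    then show "\<delta>0 m i \<le> \<delta>0 (Suc m) j"
      using F.d_matrix[of m] by (simp add: coefficient_matrix_def)
  next
    fix i m j
    assume "i < N0 (Suc m)" "j < N0 (Suc (Suc m))" "D0 (Suc (Suc m)) $$ (i, j) \<noteq> 0"
    then show "\<delta>0 (Suc m) i \<noteq> \<delta>0 (Suc (Suc m)) j"
      by (rule based_map.degree_neq_if_minimal[OF F.differential min])
  next
    fix J c
    assume "J \<subseteq> {..<N0 1}" "card J \<le> r" "\<And>i. c i \<noteq> 0 \<Longrightarrow> i \<in> J"
      and "mat_apply (D0 1) (N0 0) (N0 1) c = 0"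
    then show "c = 0"
      using columns_independent_if_uniform_rank[OF C r_le rank, of J c] assms(20) by (simp add: zero_defs)
  next
    fix I assume "I \<subseteq> {..<N0 1}" "r + 1 \<le> card I"
    then show "f (Sup_fin (\<delta>0 1 ` I)) = Sup_fin ((\<lambda>i. f (\<delta>0 1 i)) ` I)"
      using join[of I] assms(20,22) by (simp add: zero_defs)
  qed

  have "relabelable f (lcm_lattice e a) N \<delta> D"
    unfolding relabelable_def
  proof (intro conjI allI impI)
    fix m i :: nat assume "1 \<le> m" and i: "i < N m"
    then obtain n where m: "m = Suc n" by (cases m) auto
    have i0: "i < N0 (Suc n)" using i m by (simp add: zero_defs)
    have "\<delta> m i = Sup_fin (a ` R.atoms_below (\<delta>0 (Suc n) i))"
      using R.degree_eq_Sup_atoms_below[OF i0] assms(22) by (simp add: m zero_defs)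
    moreover have "R.atoms_below (\<delta>0 (Suc n) i) \<subseteq> {..<e}"
      using assms(20) unfolding R.atoms_below_def by (auto simp: zero_defs)
    ultimately show "\<delta> m i \<in> lcm_lattice e a"
      using R.atoms_below_nonempty[OF i0] unfolding lcm_lattice_def by blast
  next
    fix m i j :: nat
    assume "1 \<le> m" and ij: "i < N m" "j < N (Suc m)" "D (Suc m) $$ (i, j) \<noteq> 0"
    then obtain n where "m = Suc n" by (cases m) auto
    then show "f (\<delta> m i) \<le> f (\<delta> (Suc m) j)"
      using R.f_homogeneous[of i n j] ij by (simp add: zero_defs)
  qed
  moreover have "free_resolution_coker sc' T' d' E' G' \<phi>'"
    if rel: "relabeled f N \<delta> D sc' E' G' \<phi>' \<epsilon>' T' d'" for T' d'
  proof -
    have T'0: "T' 0 = G'" and T'1: "T' 1 = E'"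
      and d'1: "\<And>u. u \<in> underlying sc' E' \<Longrightarrow> d' (Suc 0) u = \<phi>' u"
      and T'_graded: "\<And>m. multigraded_module sc' (T' (Suc m))"
      and d'_linear: "\<And>m. linear_between sc' (T' (Suc (Suc m))) (T' (Suc m)) (d' (Suc (Suc m)))"
      using rel by (auto simp: relabeled_def)
    obtain t' where t'1: "t' 1 = \<epsilon>'" and bases: "complex_bases sc' T' d' N t' (\<lambda>m i. f (\<delta> m i)) D"
      using rel by (auto simp: relabeled_def)
    have \<phi>'_linear: "linear_between sc' E' G' \<phi>'"
      using assms(8) by (simp add: multigraded_map_def)
    define N1 t1 \<delta>1 D1 where "N1 = N(0 := g')" and "t1 = t'(0 := \<gamma>')"
      and "\<delta>1 = (\<lambda>m i. f (\<delta> m i))(0 := b')" and "D1 = D(Suc 0 := C')"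
    note one_defs = N1_def t1_def \<delta>1_def D1_def
    interpret E': based_module sc' E' e \<epsilon>' a'
      by (intro based_module.intro based_module_axioms.intro Q'.module_axioms graded E'_basis)
    interpret T': based_complex sc' T' d' N1 t1 \<delta>1 D1
    proof (intro based_complex.intro based_complex_axioms.intro Q'.module_axioms)
      fix m
      show "multigraded_module sc' (T' m)"
        by (cases m) (simp_all add: T'0 graded T'_graded)
      show "homogeneous_basis sc' (T' m) (N1 m) (t1 m) (\<delta>1 m)"
        using G'_basis bases T'0 by (cases m) (simp_all add: one_defs complex_bases_def)
      show "linear_between sc' (T' (Suc m)) (T' m) (d' (Suc m))"
      proof (cases m)
        case 0
        have "sc' q u \<in> underlying sc' E'" if "u \<in> underlying sc' E'" for q u
          using that unfolding underlying_def by (rule Q'.span_scale)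
        moreover have "u + v \<in> underlying sc' E'"
          if "u \<in> underlying sc' E'" "v \<in> underlying sc' E'" for u v
          using that unfolding underlying_def by (rule Q'.span_add)
        ultimately show ?thesis
          using \<phi>'_linear T'1 by (simp add: 0 T'0 linear_between_def d'1)
      qed (simp add: d'_linear)
      show "coefficient_matrix sc' (d' (Suc m)) (N1 (Suc m)) (t1 (Suc m)) (\<delta>1 (Suc m))
          (N1 m) (t1 m) (\<delta>1 m) (D1 (Suc m))"
      proof (cases m)
        case 0
        have "\<epsilon>' j \<in> underlying sc' E'" if "j < e" for j
          using E'.basis_in[OF that] E'.subset_underlying by auto
        then show ?thesis
          using C'_matrix assms(13,20,22) t'1 by (simp add: 0 one_defs coefficient_matrix_def d'1)
      next
        case (Suc n)
        then show ?thesis using bases by (simp add: one_defs complex_bases_def)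
      qed
    qed
    have "strands_exact N1 \<delta>1 D1"
    proof (rule R.relabeled_strands_exact)
      show "mat_apply (D1 1) (N1 0) (N0 1) c = 0 \<longleftrightarrow> mat_apply (D0 1) (N0 0) (N0 1) c = 0" for c
        using kernel[of c] assms(20) by (simp add: zero_defs one_defs)
    qed (simp_all add: zero_defs one_defs)
    then have T'_exact: "\<forall>m. {u \<in> underlying sc' (T' (Suc m)). d' (Suc m) u = 0}
        = d' (Suc (Suc m)) ` underlying sc' (T' (Suc (Suc m)))"
      using T'.exact_iff_strands_exact by simp
    obtain p where p: "\<And>m. m > p \<Longrightarrow> underlying sc (F m) = {0}"
      using F_complex by (auto simp: multigraded_complex_def)
    have "underlying sc' (T' m) = {0}" if "m > p" for m
    proof -
      interpret Fm: based_module sc "F m" "N0 m" "t0 m" "\<delta>0 m" by (rule F.level)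
      interpret Tm: based_module sc' "T' m" "N1 m" "t1 m" "\<delta>1 m" by (rule T'.level)
      \<comment> \<open>A basis contains no zero vector.\<close>
      have "N0 m = 0"
      proof (rule ccontr)
        assume "N0 m \<noteq> 0"
        then have "t0 m 0 \<in> underlying sc (F m)" "t0 m 0 \<in> t0 m ` {..<N0 m}"
          using Fm.basis_in[of 0] Fm.subset_underlying by auto
        then have "0 \<in> t0 m ` {..<N0 m}" using p[OF that] by simp
        then show False
          using F.T_basis[of m] Q.dependent_zero by (simp add: homogeneous_basis_def)
      qed
      then have "N1 m = 0" using that by (simp add: zero_defs one_defs)
      then show ?thesis using Tm.underlying_iff by auto
    qed
    moreover have "multigraded_map sc' (T' (Suc m)) (T' m) (d' (Suc m))" for m
      using T'.d_linear based_map.map_graded[OF T'.differential] by (simp add: multigraded_map_def)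
    moreover have "finite_free sc' (T' m)" for m
      unfolding finite_free_def using T'.T_graded T'.T_basis by blast
    moreover have "d' (Suc m) (d' (Suc (Suc m)) u) = 0"
      if "u \<in> underlying sc' (T' (Suc (Suc m)))" for m u
      using T'_exact that by blast
    ultimately have "multigraded_complex sc' T' d'"
      unfolding multigraded_complex_def by blast
    moreover have "d' 1 ` underlying sc' (T' 1) = \<phi>' ` underlying sc' E'"
      using T'1 d'1 by simp
    ultimately show ?thesis
      using T'0 T'_exact by (simp add: free_resolution_coker_def)
  qed
  ultimately show ?thesis by blast
qed

end
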